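(* Let $\beta=\mathrm{LB}\circ\mathrm{compl}\circ\mathrm{LB}$ on Tamari intervals (interval-posets). Then $\beta$ is an involution on Tamari intervals such that for every interval $I$ and every commutative alphabet $X$: $\mathrm{rises}(I)=\mathrm{contacts}(\beta(I))$, $\mathrm{RiseMon}(I,X)=\mathrm{ContactMon}(\beta(I),X)$, and $\mathrm{dist}(I)=\mathrm{dist}(\beta(I))$.
   Context: Interval-posets: a partial order $\triangleleft$ on $\{1,\dots,n\}$ such that for all $a<b<c$, $a\triangleleft c\Rightarrow b\triangleleft c$ and $c\triangleleft a\Rightarrow b\triangleleft a$. Relations $x\triangleleft y$ with $x<y$ are increasing, with $x>y$ decreasing. The decreasing children of $b$ are the $c>b$ with $c\triangleleft b$ a cover relation of the poset of decreasing relations. Binary tree nodes $v_1,\dots,v_n$ are numbered in in-order. Dyck paths (words in up-step $1$ / down-step $0$) correspond to binary trees via $\mathrm{tree}(D_1 1 D_2 0)=$ tree with left subtree $\mathrm{tree}(D_1)$, right subtree $\mathrm{tree}(D_2)$. The Tamari order is generated by right rotations $y(x(A,B),C)\to x(A,y(B,C))$. A Tamari interval $[T_1,T_2]$ ($T_1\le T_2$) is identified with the interval-poset where, for $a<b$, $b\triangleleft a$ iff $v_b$ is in the right subtree of $v_a$ in $T_1$, and $a\triangleleft b$ iff $v_a$ is in the left subtree of $v_b$ in $T_2$; lower/upper bound Dyck paths $D_1,D_2$ satisfy $\mathrm{tree}(D_i)=T_i$. Statistics: for a Dyck path $D$ of size $n$, $\mathrm{contacts}(D)$ = number of points at height $0$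 except the last; $\mathrm{rises}(D)$ = initial run of up-steps; $\mathrm{contacts}_i(D)$ = number of non-final contacts of the Dyck subpath strictly between the $i$-th up-step and its matching down-step; $\mathrm{rises}_i(D)$ = number of up-steps immediately after the $i$-th down-step. $\mathrm{ContactMon}(D,X)=x_{\mathrm{contacts}(D)}\prod_{i=1}^{n-1}x_{\mathrm{contacts}_i(D)}$, $\mathrm{RiseMon}(D,X)=x_{\mathrm{rises}(D)}\prod_{i=1}^{n-1}x_{\mathrm{rises}_i(D)}$. For $I=[D_1,D_2]$, contact statistics are taken on $D_1$ and rise statistics on $D_2$. $\mathrm{dist}(I)$ is the maximal length of a chain from $D_1$ to $D_2$ in the Tamari lattice. Grafting: $u$ is the interval-poset of size $1$. For interval-posets $I_1,I_2$ of sizes $n_1,n_2$, the shifted concatenation is the poset on $\{1,\dots,n_1+n_2\}$ with the relations of $I_1$ and those of $I_2$ shifted by $n_1$. For $n_2>0$, $I_1\prec I_2$ (left grafting) is the shifted concatenation plus the relations $y\triangleleft n_1+1$ for all $y\le n_1$; by convention $\emptyset\prec I_2=I_2$. For $n_1>0$ and $0\le r\le c$, where $y_1<\dots<y_c$ are the (shifted) decreasing roots of $I_2$ (vertices with no smaller vertex above them), $I_1\succ_r I_2$ (right grafting) is the shifted concatenation plus $y_i\triangleleft n_1$ for $1\le i\le r$; by convention $I_1\succ_0\emptyset=I_1$. A grafting tree is a binary tree $T$ with labeling $\ell$ of its nodes by nonnegative integers such that for every node $v$, $\ell(v)\le \mathrm{size}(T_R(v))-\sum_{w\in T_R(v)}\ell(w)$,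 $T_R(v)$ the right subtree. Define $\mathrm{Graft}^{-1}(\emptyset)=\emptyset$ and, for $T$ with root $v$, left subtree $T_L$, right subtree $T_R$, $\mathrm{Graft}^{-1}(T,\ell)=\mathrm{Graft}^{-1}(T_L,\ell)\prec\big(u\succ_{\ell(v)}\mathrm{Graft}^{-1}(T_R,\ell)\big)$; this is a bijection from grafting trees to interval-posets, with inverse $\mathrm{Graft}$. Left branch involution on binary trees: $\mathrm{LB}(\emptyset)=\emptyset$; if $T$ has root $v$, left subtree $T_L$, right subtree $T_R$, then $\mathrm{LB}(T)$ is obtained from $\mathrm{LB}(T_L)$ by attaching, as left child of the leftmost node of $\mathrm{LB}(T_L)$ (or as the whole tree if $\mathrm{LB}(T_L)$ is empty), the node $v$ with empty left subtree and right subtree $\mathrm{LB}(T_R)$. On a grafting tree, nodes carry their labels; the result is again a grafting tree. On intervals, $\mathrm{LB}(I)=\mathrm{Graft}^{-1}(\mathrm{LB}(\mathrm{Graft}(I)))$. The complement $\mathrm{compl}(I)$ of an interval-poset of size $n$ is defined by $i\triangleleft_{\mathrm{compl}(I)}j$ iff $(n+1-i)\triangleleft_I(n+1-j)$. *)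

theory Defs
  imports Complex_Main "HOL-Library.Tree"
begin

section \<open>Dyck paths\<close>

datatype step = Up | Down

definition elevation :: "step list \<Rightarrow> int" where
  "elevation w = int (count_list w Up) - int (count_list w Down)"

definition dyck_path :: "step list \<Rightarrow> bool" where
  "dyck_path w \<longleftrightarrow> (\<forall>k \<le> length w. elevation (take k w) \<ge> 0) \<and> elevation w = 0"

definition path_size :: "step list \<Rightarrow> nat" where
  "path_size D = count_list D Up"

definition last_return :: "step list \<Rightarrow> nat" where
  "last_return D = (GREATEST k. k < length D \<and> elevation (take k D) = 0)"

lemma last_return_less:
  assumes "D \<noteq> []" shows "last_return D < length D"
proof -
  have "0 < length D \<and> elevation (take 0 D) = 0"
    using assms by (simp add: elevation_def)
  then have "last_return D < length D \<and> elevation (take (last_return D) D) = 0"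
    unfolding last_return_def by (rule GreatestI_nat[where b = "length D"]) auto
  then show ?thesis ..
qed

text \<open>
  A nonempty Dyck path \<open>D\<close> factors uniquely as \<open>D\<^sub>1 1 D\<^sub>2 0\<close> with Dyck paths \<open>D\<^sub>1\<close> and \<open>D\<^sub>2\<close>;
  the factor \<open>D\<^sub>1\<close> ends at the last non-final contact of \<open>D\<close>. The recursion equation
  \<open>tree(D\<^sub>1 1 D\<^sub>2 0)\<close> = (left subtree \<open>tree(D\<^sub>1)\<close>, right subtree \<open>tree(D\<^sub>2)\<close>)
  is the lemma \<open>tree_of_path_append\<close> below. Words that are not Dyck paths get a junk value.
\<close>

function tree_of_path :: "step list \<Rightarrow> unit tree" where
  "tree_of_path D =
    (if D = [] then Leaf
     else Node (tree_of_path (take (last_return D) D)) ()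
               (tree_of_path (butlast (drop (Suc (last_return D)) D))))"
  by pat_completeness auto
termination
proof (relation "measure length")
  fix D :: "step list" assume "D \<noteq> []"
  then show "(take (last_return D) D, D) \<in> measure length"
    using last_return_less[of D] by simp
next
  fix D :: "step list" assume "D \<noteq> []"
  then show "(butlast (drop (Suc (last_return D)) D), D) \<in> measure length"
    by (cases D) auto
qed simp

declare tree_of_path.simps [simp del]

lemma tree_of_path_Nil [simp]: "tree_of_path [] = Leaf"
  by (simp add: tree_of_path.simps)

lemma last_return_append:
  assumes "dyck_path D1" "dyck_path D2"
  shows "last_return (D1 @ [Up] @ D2 @ [Down]) = length D1"
  unfolding last_return_def
proof (rule Greatest_equality)
  show "length D1 < length (D1 @ [Up] @ D2 @ [Down]) \<and>
      elevation (take (length D1) (D1 @ [Up] @ D2 @ [Down])) = 0"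
    using assms by (simp add: dyck_path_def)
next
  fix k
  assume k: "k < length (D1 @ [Up] @ D2 @ [Down]) \<and>
      elevation (take k (D1 @ [Up] @ D2 @ [Down])) = 0"
  show "k \<le> length D1"
  proof (rule ccontr)
    assume "\<not> k \<le> length D1"
    then obtain j where j: "k = length D1 + Suc j"
      by (metis less_imp_Suc_add not_le add_Suc_right)
    with k have jl: "j \<le> length D2" by simp
    have "take k (D1 @ [Up] @ D2 @ [Down]) = D1 @ [Up] @ take j D2"
      using j jl by simp
    then have "elevation (take k (D1 @ [Up] @ D2 @ [Down]))
        = elevation D1 + 1 + elevation (take j D2)"
      by (simp add: elevation_def)
    moreover have "elevation D1 = 0" "elevation (take j D2) \<ge> 0"
      using assms jl by (auto simp: dyck_path_def)
    ultimately show False using k by simp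
  qed
qed

lemma tree_of_path_append:
  assumes "dyck_path D1" "dyck_path D2"
  shows "tree_of_path (D1 @ [Up] @ D2 @ [Down]) = Node (tree_of_path D1) () (tree_of_path D2)"
  by (subst tree_of_path.simps) (simp add: last_return_append[OF assms, simplified] butlast_append)

definition contacts :: "step list \<Rightarrow> nat" where
  "contacts D = card {k. k < length D \<and> elevation (take k D) = 0}"

definition rises :: "step list \<Rightarrow> nat" where
  "rises D = length (takeWhile (\<lambda>s. s = Up) D)"

text \<open>\<open>step_pos s D i\<close>: position (counted from 0) of the \<open>i\<close>-th occurrence (counted from 1) of \<open>s\<close>.\<close>

definition step_pos :: "step \<Rightarrow> step list \<Rightarrow> nat \<Rightarrow> nat" where
  "step_pos s D i = filter (\<lambda>p. D ! p = s) [0..<length D] ! (i - 1)"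

definition matching_down :: "step list \<Rightarrow> nat \<Rightarrow> nat" where
  "matching_down D p =
    (LEAST q. p < q \<and> q < length D \<and> elevation (take (Suc q) D) = elevation (take p D))"

definition contacts_at :: "nat \<Rightarrow> step list \<Rightarrow> nat" where
  "contacts_at i D =
    (let p = step_pos Up D i; q = matching_down D p
     in contacts (take (q - Suc p) (drop (Suc p) D)))"

definition rises_at :: "nat \<Rightarrow> step list \<Rightarrow> nat" where
  "rises_at i D = rises (drop (Suc (step_pos Down D i)) D)"

text \<open>
  A commutative alphabet \<open>x\<^sub>0, x\<^sub>1, \<dots>\<close> is a family of elements of an arbitrary commutative monoid.
\<close>

definition contact_mon :: "(nat \<Rightarrow> 'a::comm_monoid_mult) \<Rightarrow> step list \<Rightarrow> 'a" where
  "contact_mon X D = X (contacts D) * (\<Prod>i = 1..path_size D - 1. X (contacts_at i D))"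

definition rise_mon :: "(nat \<Rightarrow> 'a::comm_monoid_mult) \<Rightarrow> step list \<Rightarrow> 'a" where
  "rise_mon X D = X (rises D) * (\<Prod>i = 1..path_size D - 1. X (rises_at i D))"

section \<open>The Tamari order\<close>

inductive right_rotation :: "unit tree \<Rightarrow> unit tree \<Rightarrow> bool" where
  root: "right_rotation (Node (Node A x B) y C) (Node A x (Node B y C))"
| left: "right_rotation l l' \<Longrightarrow> right_rotation (Node l x r) (Node l' x r)"
| right: "right_rotation r r' \<Longrightarrow> right_rotation (Node l x r) (Node l x r')"

definition tamari_le :: "unit tree \<Rightarrow> unit tree \<Rightarrow> bool" where
  "tamari_le = right_rotation\<^sup>*\<^sup>*"

definition tamari_less :: "unit tree \<Rightarrow> unit tree \<Rightarrow> bool" where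
  "tamari_less S T \<longleftrightarrow> tamari_le S T \<and> S \<noteq> T"

text \<open>A Tamari interval is given by its lower and upper bound Dyck paths.\<close>

type_synonym path_pair = "step list \<times> step list"

fun tamari_interval :: "path_pair \<Rightarrow> bool" where
  "tamari_interval (D1, D2) \<longleftrightarrow>
    dyck_path D1 \<and> dyck_path D2 \<and> tamari_le (tree_of_path D1) (tree_of_path D2)"

definition tamari_dist :: "unit tree \<Rightarrow> unit tree \<Rightarrow> nat" where
  "tamari_dist S T =
    Max {k. \<exists>c :: nat \<Rightarrow> unit tree. c 0 = S \<and> c k = T \<and> (\<forall>i < k. tamari_less (c i) (c (Suc i)))}"

section \<open>Interval-posets\<close>

text \<open>
  An interval-poset of size \<open>n\<close> is a pair \<open>(n, R)\<close>, where \<open>(x, y) \<in> R\<close> means \<open>x \<triangleleft> y\<close>;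
  the relation \<open>R\<close> is reflexive.
\<close>

type_synonym poset = "nat \<times> nat rel"

fun interval_poset :: "poset \<Rightarrow> bool" where
  "interval_poset (n, R) \<longleftrightarrow>
    partial_order_on {1..n} R \<and>
    (\<forall>a b c. a < b \<and> b < c \<longrightarrow>
      ((a, c) \<in> R \<longrightarrow> (b, c) \<in> R) \<and> ((c, a) \<in> R \<longrightarrow> (b, a) \<in> R))"

text \<open>\<open>number_inorder k T\<close> has the shape of \<open>T\<close>; its nodes carry \<open>k, k + 1, \<dots>\<close> in in-order.\<close>

fun number_inorder :: "nat \<Rightarrow> 'a tree \<Rightarrow> nat tree" where
  "number_inorder k Leaf = Leaf"
| "number_inorder k (Node l x r) =
    Node (number_inorder k l) (k + size l) (number_inorder (Suc (k + size l)) r)"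

definition in_left_subtree :: "'a tree \<Rightarrow> nat \<Rightarrow> nat \<Rightarrow> bool" where
  "in_left_subtree T a b \<longleftrightarrow> (\<exists>l r. Node l b r \<in> subtrees (number_inorder 1 T) \<and> a \<in> set_tree l)"

definition in_right_subtree :: "'a tree \<Rightarrow> nat \<Rightarrow> nat \<Rightarrow> bool" where
  "in_right_subtree T b a \<longleftrightarrow> (\<exists>l r. Node l a r \<in> subtrees (number_inorder 1 T) \<and> b \<in> set_tree r)"

fun poset_of_interval :: "path_pair \<Rightarrow> poset" where
  "poset_of_interval (D1, D2) =
    (path_size D1,
     Id_on {1..path_size D1}
     \<union> {(b, a). a < b \<and> in_right_subtree (tree_of_path D1) b a}
     \<union> {(a, b). a < b \<and> in_left_subtree (tree_of_path D2) a b})"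

text \<open>
  The inverse of the identification of Tamari intervals with interval-posets, which is a bijection.
\<close>

definition interval_of_poset :: "poset \<Rightarrow> path_pair" where
  "interval_of_poset = the_inv_into {J. tamari_interval J} poset_of_interval"

definition lower_path :: "poset \<Rightarrow> step list" where
  "lower_path I = fst (interval_of_poset I)"

definition upper_path :: "poset \<Rightarrow> step list" where
  "upper_path I = snd (interval_of_poset I)"

definition poset_contacts :: "poset \<Rightarrow> nat" where
  "poset_contacts I = contacts (lower_path I)"

definition poset_rises :: "poset \<Rightarrow> nat" where
  "poset_rises I = rises (upper_path I)"

definition poset_contact_mon :: "(nat \<Rightarrow> 'a::comm_monoid_mult) \<Rightarrow> poset \<Rightarrow> 'a" where
  "poset_contact_mon X I = contact_mon X (lower_path I)"

definition poset_rise_mon :: "(nat \<Rightarrow> 'a::comm_monoid_mult) \<Rightarrow> poset \<Rightarrow> 'a" where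
  "poset_rise_mon X I = rise_mon X (upper_path I)"

definition poset_dist :: "poset \<Rightarrow> nat" where
  "poset_dist I = tamari_dist (tree_of_path (lower_path I)) (tree_of_path (upper_path I))"

fun compl :: "poset \<Rightarrow> poset" where
  "compl (n, R) = (n, {(i, j). i \<in> {1..n} \<and> j \<in> {1..n} \<and> (n + 1 - i, n + 1 - j) \<in> R})"

section \<open>Grafting and the left branch involution\<close>

text \<open>
  In both grafting operations the transitive closure yields the poset generated by the listed
  relations: e.g. \<open>y\<^sub>i \<triangleleft> n\<^sub>1\<close> together with \<open>z \<triangleleft> y\<^sub>i\<close> forces \<open>z \<triangleleft> n\<^sub>1\<close>. The conventions for empty
  arguments are instances of the general formulas.
\<close>

definition unit_poset :: poset where
  "unit_poset = (1, {(1, 1)})"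

fun shifted_concat :: "poset \<Rightarrow> poset \<Rightarrow> nat rel" where
  "shifted_concat (n1, R1) (n2, R2) = R1 \<union> {(x + n1, y + n1) |x y. (x, y) \<in> R2}"

fun left_graft :: "poset \<Rightarrow> poset \<Rightarrow> poset" where
  "left_graft (n1, R1) (n2, R2) =
    (n1 + n2,
     (shifted_concat (n1, R1) (n2, R2) \<union> {(y, n1 + 1) |y. y \<in> {1..n1}})\<^sup>+)"

fun decreasing_roots :: "poset \<Rightarrow> nat set" where
  "decreasing_roots (n, R) = {y \<in> {1..n}. \<not> (\<exists>x < y. (y, x) \<in> R)}"

fun right_graft :: "poset \<Rightarrow> nat \<Rightarrow> poset \<Rightarrow> poset" where
  "right_graft (n1, R1) r (n2, R2) =
    (n1 + n2,
     (shifted_concat (n1, R1) (n2, R2) \<union>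
      {(y + n1, n1) |y. y \<in> set (take r (sorted_list_of_set (decreasing_roots (n2, R2))))})\<^sup>+)"

text \<open>
  The labelled binary tree \<open>(T, \<ell>)\<close> is a \<open>nat tree\<close> carrying the label \<open>\<ell>(v)\<close> at each node \<open>v\<close>.
  The inequality is the defining one, rearranged to avoid truncated subtraction.
\<close>

definition grafting_tree :: "nat tree \<Rightarrow> bool" where
  "grafting_tree T \<longleftrightarrow>
    (\<forall>l x r. Node l x r \<in> subtrees T \<longrightarrow> x + sum_list (inorder r) \<le> size r)"

fun graft_inv :: "nat tree \<Rightarrow> poset" where
  "graft_inv Leaf = (0, {})"
| "graft_inv (Node l x r) = left_graft (graft_inv l) (right_graft unit_poset x (graft_inv r))"

definition graft :: "poset \<Rightarrow> nat tree" where
  "graft = the_inv_into {T. grafting_tree T} graft_inv"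

fun attach_leftmost :: "'a tree \<Rightarrow> 'a tree \<Rightarrow> 'a tree" where
  "attach_leftmost Leaf S = S"
| "attach_leftmost (Node l x r) S = Node (attach_leftmost l S) x r"

fun LB_tree :: "'a tree \<Rightarrow> 'a tree" where
  "LB_tree Leaf = Leaf"
| "LB_tree (Node l x r) = attach_leftmost (LB_tree l) (Node Leaf x (LB_tree r))"

definition LB :: "poset \<Rightarrow> poset" where
  "LB I = graft_inv (LB_tree (graft I))"

definition beta :: "poset \<Rightarrow> poset" where
  "beta = LB \<circ> compl \<circ> LB"

end

theory Submission
  imports Defs "HOL-Library.Multiset"
begin

text \<open>
  An interval-poset is the union of the decreasing relations of its lower tree \<open>S\<close> and the
  increasing relations of its upper tree \<open>T\<close>. Its grafting tree is \<open>T\<close>, labelled in in-order by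
  the numbers of decreasing children, i.e. by the numbers \<open>contacts\<^sub>i\<close> of the lower path, and
  \<open>contacts\<close> is the size minus the sum of the labels. As \<open>LB\<close> moves labels along with the nodes,
  it preserves contacts and the contact monomial.

  The longest chain from \<open>S\<close> to \<open>T\<close> has as many steps as there are pairs \<open>a < b\<close> with \<open>a\<close> in the
  left subtree of \<open>b\<close> in \<open>S\<close> and \<open>b\<close> in the right subtree of \<open>a\<close> in \<open>T\<close>. This count is
  symmetric under the complement; on the grafting tree it is the sum over all nodes of the slack
  in the defining inequality, hence it is also preserved by \<open>LB\<close>.

  The complement mirrors and exchanges the two trees. So the contacts of \<open>\<beta>(I)\<close> are those of the
  mirror image of \<open>LB(T)\<close>, and by induction on \<open>T\<close> these are the rises of the path of \<open>T\<close>.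
\<close>

section \<open>Right and left subtree relations\<close>

text \<open>
  Nodes carry the in-order numbers \<open>k, k + 1, \<dots>\<close>. As for interval-posets, the descendant comes
  first: \<open>(b, a) \<in> right_rel k T\<close> means that \<open>b\<close> lies in the right subtree of \<open>a\<close>, and
  \<open>(a, b) \<in> left_rel k T\<close> that \<open>a\<close> lies in the left subtree of \<open>b\<close>.
\<close>

fun right_rel :: "nat \<Rightarrow> 'a tree \<Rightarrow> nat rel" where
  "right_rel k Leaf = {}"
| "right_rel k (Node l x r) = right_rel k l \<union> right_rel (Suc (k + size l)) r \<union>
    {Suc (k + size l)..<Suc (k + size l + size r)} \<times> {k + size l}"

fun left_rel :: "nat \<Rightarrow> 'a tree \<Rightarrow> nat rel" where
  "left_rel k Leaf = {}"
| "left_rel k (Node l x r) = left_rel k l \<union> left_rel (Suc (k + size l)) r \<union>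
    {k..<k + size l} \<times> {k + size l}"

lemma right_rel_range: "(b, a) \<in> right_rel k T \<Longrightarrow> k \<le> a \<and> a < b \<and> b < k + size T"
  by (induction k T rule: right_rel.induct) fastforce+

lemma left_rel_range: "(a, b) \<in> left_rel k T \<Longrightarrow> k \<le> a \<and> a < b \<and> b < k + size T"
  by (induction k T rule: left_rel.induct) fastforce+

lemma finite_left_rel [simp]: "finite (left_rel k T)"
  by (induction k T rule: left_rel.induct) auto

lemma right_rel_map [simp]: "right_rel k (map_tree f T) = right_rel k T"
  by (induction k T rule: right_rel.induct) auto

text \<open>Reflection reverses the in-order numbering; it is written with sums to avoid truncated
  subtraction. The offsets \<open>k\<close> and \<open>k'\<close> are independent because the two
  copies of a subtree start at different numbers in the induction.\<close>

lemma right_rel_mirror: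
  assumes "a + a' + 1 = k + k' + size T" "b + b' + 1 = k + k' + size T"
  shows "(b, a) \<in> right_rel k (mirror T) \<longleftrightarrow> (b', a') \<in> left_rel k' T"
  using assms
proof (induction T arbitrary: k k')
  case Leaf
  then show ?case by simp
next
  case (Node l x r)
  have l: "(b, a) \<in> right_rel (Suc (k + size r)) (mirror l) \<longleftrightarrow> (b', a') \<in> left_rel k' l"
    by (rule Node.IH) (use Node.prems in auto)
  have r: "(b, a) \<in> right_rel k (mirror r) \<longleftrightarrow> (b', a') \<in> left_rel (Suc (k' + size l)) r"
    by (rule Node.IH) (use Node.prems in auto)
  have "(b, a) \<in> {Suc (k + size r)..<Suc (k + size r + size l)} \<times> {k + size r} \<longleftrightarrow>
      (b', a') \<in> {k'..<k' + size l} \<times> {k' + size l}"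
    using Node.prems by auto
  with l r show ?case by auto
qed

lemma right_rel_trans: "trans (right_rel k T)"
proof (induction k T rule: right_rel.induct)
  case (2 k l x r)
  show ?case
  proof (rule transI)
    fix a b c
    assume "(a, b) \<in> right_rel k (Node l x r)" "(b, c) \<in> right_rel k (Node l x r)"
    then show "(a, c) \<in> right_rel k (Node l x r)"
      using transD[OF 2(1), of a b c] transD[OF 2(2), of a b c]
        right_rel_range[of a b k l] right_rel_range[of a b "Suc (k + size l)" r]
        right_rel_range[of b c k l] right_rel_range[of b c "Suc (k + size l)" r] by auto
  qed
qed simp

lemma right_rel_convex: "(c, a) \<in> right_rel k T \<Longrightarrow> a < b \<Longrightarrow> b < c \<Longrightarrow> (b, a) \<in> right_rel k T"
proof (induction k T rule: right_rel.induct)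
  case (2 k l x r)
  then show ?case by (auto dest: right_rel_range)
qed simp

lemma left_rel_trans: "trans (left_rel k T)"
proof (induction k T rule: left_rel.induct)
  case (2 k l x r)
  show ?case
  proof (rule transI)
    fix a b c
    assume "(a, b) \<in> left_rel k (Node l x r)" "(b, c) \<in> left_rel k (Node l x r)"
    then show "(a, c) \<in> left_rel k (Node l x r)"
      using transD[OF 2(1), of a b c] transD[OF 2(2), of a b c]
        left_rel_range[of a b k l] left_rel_range[of a b "Suc (k + size l)" r]
        left_rel_range[of b c k l] left_rel_range[of b c "Suc (k + size l)" r] by auto
  qed
qed simp

lemma left_rel_convex: "(a, c) \<in> left_rel k T \<Longrightarrow> a < b \<Longrightarrow> b < c \<Longrightarrow> (b, c) \<in> left_rel k T"
proof (induction k T rule: left_rel.induct)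
  case (2 k l x r)
  then show ?case by (auto dest: left_rel_range)
qed simp

lemma left_right_rel_disjoint: "(a, b) \<in> left_rel k T \<Longrightarrow> (b, a) \<notin> right_rel k T"
  by (induction k T rule: left_rel.induct) (fastforce dest: left_rel_range right_rel_range)+

text \<open>The lowest common ancestor of \<open>a\<close> and \<open>b\<close> serves as
  \<open>c\<close>: it lies between them in in-order, and it is not \<open>a\<close> because
  \<open>b\<close> is outside the right subtree of \<open>a\<close>.\<close>

lemma left_rel_obstruction:
  "k \<le> a \<Longrightarrow> a < b \<Longrightarrow> b < k + size T \<Longrightarrow> (b, a) \<notin> right_rel k T \<Longrightarrow>
    \<exists>c. a < c \<and> c \<le> b \<and> (a, c) \<in> left_rel k T"
proof (induction k T rule: left_rel.induct)
  case (2 k l x r)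
  consider "b < k + size l" | "a < k + size l" "k + size l \<le> b" | "a = k + size l" | "k + size l < a"
    by linarith
  then show ?case
  proof cases
    case 1 then show ?thesis using 2 by fastforce
  next
    case 2 then show ?thesis using \<open>k \<le> a\<close> by (intro exI[of _ "k + size l"]) auto
  next
    case 3 then show ?thesis using 2 by auto
  next
    case 4 then show ?thesis using 2 by fastforce
  qed
qed simp

text \<open>If the roots had different numbers, the earlier one would have the later one in its
  right subtree in one tree but not in the other. The size is needed as well: left combs of all
  sizes have the empty relation.\<close>

lemma right_rel_inject:
  fixes S T :: "unit tree"
  shows "right_rel k S = right_rel k T \<Longrightarrow> size S = size T \<Longrightarrow> S = T"
proof (induction S arbitrary: k T)
  case Leaf
  then show ?case by auto
next
  case (Node l x r)
  then obtain l' y r' where T: "T = Node l' y r'" by (cases T) auto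
  have key: False if "size u < size u'" "size u + size v = size u' + size v'"
      "right_rel k (Node u () v) \<subseteq> right_rel k (Node u' () v')" for u v u' v' :: "unit tree"
  proof -
    have "(k + size u', k + size u) \<in> right_rel k (Node u () v)" using that by auto
    with that have "(k + size u', k + size u) \<in> right_rel k (Node u' () v')" by blast
    with that show False by (auto dest: right_rel_range)
  qed
  have sz: "size l = size l'"
    using key[of l l' r r'] key[of l' l r' r] Node.prems T by (cases "size l" "size l'" rule: linorder_cases) auto
  have eql: "right_rel k l = right_rel k l'"
  proof -
    have "right_rel k u = right_rel k (Node u () v) \<inter> {p. fst p < k + size u}" for u v :: "unit tree"
      by (auto dest: right_rel_range)
    from this[of l r] this[of l' r'] show ?thesis using Node.prems(1) T sz by simp
  qed
  have eqr: "right_rel (Suc (k + size l)) r = right_rel (Suc (k + size l)) r'"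
  proof -
    have "right_rel (Suc (k + size u)) v = right_rel k (Node u () v) \<inter> {p. k + size u < snd p}" for u v :: "unit tree"
      by (auto dest: right_rel_range)
    from this[of l r] this[of l' r'] show ?thesis using Node.prems(1) T sz by simp
  qed
  show ?case using Node.IH(1)[OF eql sz] Node.IH(2)[OF eqr] Node.prems(2) T sz by simp
qed

lemma left_rel_inject:
  fixes S T :: "unit tree"
  assumes "left_rel k S = left_rel k T" "size S = size T"
  shows "S = T"
proof -
  have "right_rel k (mirror S) = right_rel k (mirror T)"
  proof -
    \<comment> \<open>This expresses the mirrored relation through \<open>left_rel k U\<close> and
      \<open>size U\<close> alone; vertex \<open>x\<close> is reflected to
      \<open>2 * k + size U - 1 - x\<close>.\<close>
    have "right_rel k (mirror U) = {(b, a). a \<le> 2 * k + size U - 1 \<and> b \<le> 2 * k + size U - 1 \<and>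
        (2 * k + size U - 1 - b, 2 * k + size U - 1 - a) \<in> left_rel k U}" for U :: "unit tree"
    proof (intro set_eqI, clarify)
      fix b a
      let ?m = "2 * k + size U - 1"
      show "(b, a) \<in> right_rel k (mirror U) \<longleftrightarrow> (b, a) \<in> {(b, a). a \<le> ?m \<and> b \<le> ?m \<and> (?m - b, ?m - a) \<in> left_rel k U}"
      \<comment> \<open>Nonemptiness keeps \<open>2 * k + size U - 1\<close> from being truncated
        when \<open>k = 0\<close>.\<close>
      proof (cases "a \<le> ?m \<and> b \<le> ?m \<and> size U > 0")
        case True
        then have "(b, a) \<in> right_rel k (mirror U) \<longleftrightarrow> (?m - b, ?m - a) \<in> left_rel k U"
          by (intro right_rel_mirror) auto
        with True show ?thesis by simp
      next
        case False
        have "(b, a) \<notin> right_rel k (mirror U)" 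
        proof
          assume "(b, a) \<in> right_rel k (mirror U)"
          from right_rel_range[OF this] False show False by auto
        qed
        then show ?thesis using False by auto
      qed
    qed
    then show ?thesis using assms by simp
  qed
  then have "mirror S = mirror T" using assms by (intro right_rel_inject) auto
  then show ?thesis by (metis mirror_mirror)
qed

section \<open>Relations realised by a binary tree\<close>

definition down_convex :: "nat rel \<Rightarrow> bool" where
  "down_convex D \<longleftrightarrow> (\<forall>a b c. (c, a) \<in> D \<longrightarrow> a < b \<longrightarrow> b < c \<longrightarrow> (b, a) \<in> D)"

lemma down_convexD: "down_convex D \<Longrightarrow> (c, a) \<in> D \<Longrightarrow> a < b \<Longrightarrow> b < c \<Longrightarrow> (b, a) \<in> D"
  unfolding down_convex_def by blast

lemma down_convex_right_rel: "down_convex (right_rel k T)"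
  unfolding down_convex_def using right_rel_convex by blast

text \<open>The least vertex that has all later vertices of the window below it becomes the root;
  the two remaining segments are treated recursively. Only pairs \<open>(b, a)\<close> with
  \<open>a < b\<close> are compared, so \<open>D\<close> may be a whole interval-poset.\<close>

lemma right_rel_exists:
  assumes "trans D" "down_convex D"
  shows "\<exists>T :: unit tree. size T = n \<and>
    (\<forall>a b. k \<le> a \<longrightarrow> a < b \<longrightarrow> b < k + n \<longrightarrow> ((b, a) \<in> D \<longleftrightarrow> (b, a) \<in> right_rel k T))"
proof (induction n arbitrary: k rule: less_induct)
  case (less n)
  show ?case
  proof (cases "n = 0")
    case True
    then show ?thesis by (intro exI[of _ Leaf]) auto
  next
    case False
    define P where "P i \<longleftrightarrow> k \<le> i \<and> i < k + n \<and> (\<forall>b. i < b \<longrightarrow> b < k + n \<longrightarrow> (b, i) \<in> D)" for i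
    define i where "i = (LEAST i. P i)"
    \<comment> \<open>The last vertex of the window satisfies \<open>P\<close> vacuously, so the
      \<open>LEAST\<close> exists.\<close>
    have "P (k + n - 1)" using False unfolding P_def by auto
    then have Pi: "P i" unfolding i_def by (rule LeastI)
    have min: "\<not> P a" if "a < i" for a using that unfolding i_def by (rule not_less_Least)
    obtain j where j: "i = k + j" using Pi P_def le_Suc_ex by blast
    obtain m where m: "n = j + m + 1"
      using Pi P_def j by (metis Suc_eq_plus1 add_Suc_right less_iff_Suc_add nat_add_left_cancel_less)
    obtain l :: "unit tree" where l: "size l = j"
      "\<And>a b. k \<le> a \<Longrightarrow> a < b \<Longrightarrow> b < k + j \<Longrightarrow> (b, a) \<in> D \<longleftrightarrow> (b, a) \<in> right_rel k l"
      using less.IH[of j k] m by auto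
    obtain r :: "unit tree" where r: "size r = m"
      "\<And>a b. Suc (k + j) \<le> a \<Longrightarrow> a < b \<Longrightarrow> b < Suc (k + j) + m \<Longrightarrow>
        (b, a) \<in> D \<longleftrightarrow> (b, a) \<in> right_rel (Suc (k + j)) r"
      using less.IH[of m "Suc (k + j)"] m by auto
    \<comment> \<open>A relation across \<open>i\<close> would, by convexity and by transitivity
      through \<open>i\<close>, put all later vertices of the window below \<open>a\<close>, against
      the minimality of \<open>i\<close>.\<close>
    have cross: "(b, a) \<notin> D" if "k \<le> a" "a < i" "i \<le> b" "b < k + n" for a b
    proof
      assume "(b, a) \<in> D"
      then have ia: "(i, a) \<in> D" using down_convexD[OF assms(2)] that by (cases "i = b") auto
      have "(c, a) \<in> D" if "a < c" "c < k + n" for c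
        using ia down_convexD[OF assms(2) ia, of c] Pi transD[OF assms(1), of c i a] that unfolding P_def
        by (cases c i rule: linorder_cases) auto
      then have "P a" using that unfolding P_def by auto
      then show False using min that by blast
    qed
    show ?thesis
    proof (intro exI[of _ "Node l () r"] conjI allI impI)
      show "size (Node l () r) = n" using l r m by simp
      fix a b assume ab: "k \<le> a" "a < b" "b < k + n"
      consider "b < i" | "a < i" "i \<le> b" | "a = i" | "i < a" by linarith
      then show "(b, a) \<in> D \<longleftrightarrow> (b, a) \<in> right_rel k (Node l () r)"
      proof cases
        case 1
        then show ?thesis using ab l j by (auto dest: right_rel_range)
      next
        case 2
        then show ?thesis using cross[of a b] ab l j by (auto dest: right_rel_range)
      next
        case 3
        then show ?thesis using Pi ab l j r m unfolding P_def by auto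
      next
        case 4
        then show ?thesis using ab l j r m by (auto dest: right_rel_range)
      qed
    qed
  qed
qed

section \<open>Interval-posets as pairs of trees\<close>

definition tree_poset :: "unit tree \<Rightarrow> unit tree \<Rightarrow> poset" where
  "tree_poset S T = (size S, Id_on {1..size S} \<union> right_rel 1 S \<union> left_rel 1 T)"

text \<open>By \<open>tamari_le_iff\<close> below, this is the Tamari order \<open>S \<le> T\<close>.\<close>

definition compatible :: "unit tree \<Rightarrow> unit tree \<Rightarrow> bool" where
  "compatible S T \<longleftrightarrow> size S = size T \<and> right_rel 1 S \<subseteq> right_rel 1 T"

lemma tree_poset_inject:
  assumes "tree_poset S T = tree_poset S' T'" "size S = size T" "size S' = size T'"
  shows "S = S' \<and> T = T'"
proof -
  have sz: "size S = size S'" using assms by (simp add: tree_poset_def)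
  have eq: "Id_on {1..size S} \<union> right_rel 1 S \<union> left_rel 1 T =
      Id_on {1..size S'} \<union> right_rel 1 S' \<union> left_rel 1 T'"
    using assms(1) unfolding tree_poset_def by (rule prod.inject[THEN iffD1, THEN conjunct2])
  \<comment> \<open>The two trees are recovered from the union as its strictly decreasing and
    strictly increasing parts.\<close>
  have R: "right_rel 1 U = (Id_on {1..n} \<union> right_rel 1 U \<union> left_rel 1 V) \<inter> {(b, a). a < b}"
    for U V :: "unit tree" and n
    by (auto dest: right_rel_range left_rel_range)
  have L: "left_rel 1 V = (Id_on {1..n} \<union> right_rel 1 U \<union> left_rel 1 V) \<inter> {(a, b). a < b}"
    for U V :: "unit tree" and n
    by (auto dest: right_rel_range left_rel_range)
  have "right_rel 1 S = right_rel 1 S'"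
    using R[of S "size S" T] R[of S' "size S'" T'] eq by metis
  moreover have "left_rel 1 T = left_rel 1 T'"
    using L[of T "size S" S] L[of T' "size S'" S'] eq by metis
  ultimately show ?thesis
    using sz assms right_rel_inject[of 1 S S'] left_rel_inject[of 1 T T'] by simp
qed

text \<open>Each relation is transitive and convex by itself; compatibility matters where the two
  meet. By \<open>disj\<close> no pair is related in both directions, which excludes the bad case of
  every mixed composition.\<close>

lemma interval_poset_tree_poset:
  assumes "compatible S T"
  shows "interval_poset (tree_poset S T)"
proof -
  let ?R = "Id_on {1..size S} \<union> right_rel 1 S \<union> left_rel 1 T"
  have sz: "size S = size T" and sub: "right_rel 1 S \<subseteq> right_rel 1 T"
    using assms by (auto simp: compatible_def)
  have disj: "(a, b) \<notin> left_rel 1 T" if "(b, a) \<in> right_rel 1 S" for a b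
    using that sub left_right_rel_disjoint[of a b 1 T] by blast
  \<comment> \<open>If \<open>c\<close> were strictly between \<open>a\<close> and \<open>b\<close>,
    convexity would relate \<open>c\<close> and \<open>b\<close> in both directions. Otherwise
    \<open>c = a\<close>, or convexity of the decreasing relation applies.\<close>
  have down: "(a, c) \<in> ?R" if "(a, b) \<in> left_rel 1 T" "(b, c) \<in> right_rel 1 S" for a b c
  proof (cases a c rule: linorder_cases)
    case less
    then have "(c, b) \<in> left_rel 1 T"
      using left_rel_convex[OF that(1), of c] right_rel_range[OF that(2)] by auto
    with disj[OF that(2)] show ?thesis by blast
  next
    case equal
    with right_rel_range[OF that(2)] sz show ?thesis by auto
  next
    case greater
    with right_rel_convex[OF that(2), of a] left_rel_range[OF that(1)] show ?thesis by auto
  qed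
  have up: "(a, c) \<in> ?R" if "(a, b) \<in> right_rel 1 S" "(b, c) \<in> left_rel 1 T" for a b c
  proof (cases a c rule: linorder_cases)
    case less
    with left_rel_convex[OF that(2), of a] right_rel_range[OF that(1)] show ?thesis by auto
  next
    case equal
    with left_rel_range[OF that(2)] sz show ?thesis by auto
  next
    case greater
    then have "(c, b) \<in> right_rel 1 S"
      using right_rel_convex[OF that(1), of c] left_rel_range[OF that(2)] by auto
    with disj that(2) show ?thesis by blast
  qed
  have "trans ?R"
  proof (rule transI)
    fix a b c assume "(a, b) \<in> ?R" "(b, c) \<in> ?R"
    then show "(a, c) \<in> ?R"
      using up[of a b c] down[of a b c] transD[OF right_rel_trans[of 1 S], of a b c]
        transD[OF left_rel_trans[of 1 T], of a b c] by blast
  qed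
  moreover have "antisym ?R"
  proof (rule antisymI)
    fix a b assume "(a, b) \<in> ?R" "(b, a) \<in> ?R"
    then show "a = b"
      using disj[of a b] disj[of b a] right_rel_range[of a b 1 S] right_rel_range[of b a 1 S]
        left_rel_range[of a b 1 T] left_rel_range[of b a 1 T] by auto
  qed
  moreover have "?R \<subseteq> {1..size S} \<times> {1..size S}"
  proof (rule subrelI)
    fix a b assume "(a, b) \<in> ?R"
    then show "(a, b) \<in> {1..size S} \<times> {1..size S}"
      using sz right_rel_range[of a b 1 S] left_rel_range[of a b 1 T] by auto
  qed
  moreover have "refl_on {1..size S} ?R" by (auto simp: refl_on_def)
  moreover have "(b, c) \<in> ?R" if "(a, c) \<in> ?R" "a < b" "b < c" for a b c
    using that left_rel_convex[of a c 1 T b] by (auto dest: right_rel_range)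
  moreover have "(b, a) \<in> ?R" if "(c, a) \<in> ?R" "a < b" "b < c" for a b c
    using that right_rel_convex[of c a 1 S b] by (auto dest: left_rel_range)
  ultimately show ?thesis
    unfolding tree_poset_def interval_poset.simps partial_order_on_def preorder_on_def by blast
qed

text \<open>The decreasing relations are realised by a tree directly, the increasing ones after a
  reflection of the numbering; the second tree is then mirrored back.\<close>

lemma interval_poset_cases:
  assumes "interval_poset I"
  obtains S T where "compatible S T" "I = tree_poset S T"
proof -
  obtain n R where I: "I = (n, R)" by (cases I)
  from assms I have po: "partial_order_on {1..n} R"
    and conv: "\<And>a b c. a < b \<Longrightarrow> b < c \<Longrightarrow> (a, c) \<in> R \<Longrightarrow> (b, c) \<in> R"
      "\<And>a b c. a < b \<Longrightarrow> b < c \<Longrightarrow> (c, a) \<in> R \<Longrightarrow> (b, a) \<in> R" by auto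
  note po = partial_order_onD[OF po]
  have "down_convex R" unfolding down_convex_def using conv(2) by blast
  then obtain S :: "unit tree" where S: "size S = n"
    "\<And>a b. 1 \<le> a \<Longrightarrow> a < b \<Longrightarrow> b < 1 + n \<Longrightarrow> (b, a) \<in> R \<longleftrightarrow> (b, a) \<in> right_rel 1 S"
    using right_rel_exists[OF po(2), where n = n and k = 1] by auto
  let ?D = "{(b, a). 1 \<le> a \<and> a \<le> n \<and> 1 \<le> b \<and> b \<le> n \<and> (n + 1 - b, n + 1 - a) \<in> R}"
  have "trans ?D" by (rule transI) (use transD[OF po(2)] in blast)
  moreover have "down_convex ?D"
    unfolding down_convex_def
  proof (intro allI impI)
    fix a b c assume "(c, a) \<in> ?D" "a < b" "b < c"
    then show "(b, a) \<in> ?D"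
      using conv(1)[of "n + 1 - c" "n + 1 - b" "n + 1 - a"] by auto
  qed
  ultimately obtain T :: "unit tree" where T: "size T = n"
    "\<And>a b. 1 \<le> a \<Longrightarrow> a < b \<Longrightarrow> b < 1 + n \<Longrightarrow> (b, a) \<in> ?D \<longleftrightarrow> (b, a) \<in> right_rel 1 T"
    using right_rel_exists[of ?D, where n = n and k = 1] by blast
  have T': "(a, b) \<in> R \<longleftrightarrow> (a, b) \<in> left_rel 1 (mirror T)" if "1 \<le> a" "a < b" "b < 1 + n" for a b
  proof -
    have "(n + 1 - a, n + 1 - b) \<in> right_rel 1 T \<longleftrightarrow> (a, b) \<in> left_rel 1 (mirror T)"
      using right_rel_mirror[of "n + 1 - b" b 1 1 "mirror T" "n + 1 - a" a] that T(1) by simp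
    moreover have "(n + 1 - a, n + 1 - b) \<in> ?D \<longleftrightarrow> (n + 1 - a, n + 1 - b) \<in> right_rel 1 T"
      using that by (intro T(2)) linarith+
    moreover have "(n + 1 - a, n + 1 - b) \<in> ?D \<longleftrightarrow> (a, b) \<in> R"
    proof -
      have "n + 1 - (n + 1 - a) = a" "n + 1 - (n + 1 - b) = b" using that by linarith+
      moreover have "1 \<le> n + 1 - b" "n + 1 - b \<le> n" "1 \<le> n + 1 - a" "n + 1 - a \<le> n"
        using that by linarith+
      ultimately show ?thesis by simp
    qed
    ultimately show ?thesis by blast
  qed
  have "R = Id_on {1..n} \<union> right_rel 1 S \<union> left_rel 1 (mirror T)"
  proof (intro set_eqI, clarify)
    fix a b
    show "(a, b) \<in> R \<longleftrightarrow> (a, b) \<in> Id_on {1..n} \<union> right_rel 1 S \<union> left_rel 1 (mirror T)"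
    proof (cases "1 \<le> a \<and> a \<le> n \<and> 1 \<le> b \<and> b \<le> n")
      case True
      then show ?thesis
        using S(2)[of b a] T'[of a b] po(1) right_rel_range[of a b 1 S] left_rel_range[of a b 1 "mirror T"]
        by (cases a b rule: linorder_cases) (auto simp: refl_on_def)
    next
      case False
      then show ?thesis
        using po(4) S(1) T(1) right_rel_range[of a b 1 S] left_rel_range[of a b 1 "mirror T"] by auto
    qed
  qed
  then have "I = tree_poset S (mirror T)" by (simp add: tree_poset_def I S)
  moreover have "compatible S (mirror T)"
    unfolding compatible_def
  proof (intro conjI subrelI)
    show "size S = size (mirror T)" using S T by simp
    fix b a assume ba: "(b, a) \<in> right_rel 1 S"
    note rng = right_rel_range[OF this]
    show "(b, a) \<in> right_rel 1 (mirror T)"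
    \<comment> \<open>The obstruction gives \<open>a < c <= b\<close> with \<open>a\<close> below
      \<open>c\<close>, whereas convexity puts \<open>c\<close> below \<open>a\<close>; antisymmetry
      of \<open>R\<close> is violated.\<close>
    proof (rule ccontr)
      assume "(b, a) \<notin> right_rel 1 (mirror T)"
      then obtain c where c: "a < c" "c \<le> b" "(a, c) \<in> left_rel 1 (mirror T)"
        using left_rel_obstruction[of 1 a b "mirror T"] rng S T by auto
      have "(c, a) \<in> right_rel 1 S" using right_rel_convex[OF ba, of c] c ba by (cases "c = b") auto
      then have "(c, a) \<in> R" "(a, c) \<in> R" using S(2)[of a c] T'[of a c] c rng S(1) by auto
      with po(3) c(1) show False by (auto dest: antisymD)
    qed
  qed
  ultimately show ?thesis using that by blast
qed

lemma compl_tree_poset: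
  assumes "size S = size T"
  shows "compl (tree_poset S T) = tree_poset (mirror T) (mirror S)"
proof -
  let ?n = "size T"
  have "(a, b) \<in> {(i, j). i \<in> {1..?n} \<and> j \<in> {1..?n} \<and>
      (?n + 1 - i, ?n + 1 - j) \<in> Id_on {1..?n} \<union> right_rel 1 S \<union> left_rel 1 T} \<longleftrightarrow>
    (a, b) \<in> Id_on {1..?n} \<union> right_rel 1 (mirror T) \<union> left_rel 1 (mirror S)" for a b
  proof (cases "a \<in> {1..?n} \<and> b \<in> {1..?n}")
    case True
    have "(a, b) \<in> right_rel 1 (mirror T) \<longleftrightarrow> (?n + 1 - a, ?n + 1 - b) \<in> left_rel 1 T"
      by (rule right_rel_mirror) (use True in auto)
    moreover have "(?n + 1 - a, ?n + 1 - b) \<in> right_rel 1 (mirror (mirror S)) \<longleftrightarrow>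
        (a, b) \<in> left_rel 1 (mirror S)"
      by (rule right_rel_mirror) (use True assms in auto)
    moreover have "(?n + 1 - a, ?n + 1 - b) \<in> Id_on {1..?n} \<longleftrightarrow> (a, b) \<in> Id_on {1..?n}"
      using True by (auto simp: Id_on_iff)
    ultimately show ?thesis using True by auto
  next
    case False
    then show ?thesis
      using assms right_rel_range[of a b 1 "mirror T"] left_rel_range[of a b 1 "mirror S"] by auto
  qed
  then show ?thesis unfolding tree_poset_def using assms by auto
qed

text \<open>Mirroring reverses the Tamari order. A failing inclusion yields, through
  \<open>left_rel_obstruction\<close>, a pair related in both directions in
  \<open>T\<close>.\<close>

lemma compatible_mirror:
  assumes "compatible S T"
  shows "compatible (mirror T) (mirror S)"
proof -
  have sz: "size S = size T" using assms by (simp add: compatible_def)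
  have "(b, a) \<in> right_rel 1 (mirror S)" if "(b, a) \<in> right_rel 1 (mirror T)" for a b
  proof (rule ccontr)
    assume n: "(b, a) \<notin> right_rel 1 (mirror S)"
    note rng = right_rel_range[OF that]
    obtain c where c: "a < c" "c \<le> b" "(a, c) \<in> left_rel 1 (mirror S)"
      using left_rel_obstruction[of 1 a b "mirror S"] rng sz n by auto
    have ca: "(c, a) \<in> right_rel 1 (mirror T)" using right_rel_convex[OF that, of c] c that by (cases "c = b") auto
    have "(size T + 1 - a, size T + 1 - c) \<in> right_rel 1 (mirror (mirror S)) \<longleftrightarrow> (a, c) \<in> left_rel 1 (mirror S)"
      by (rule right_rel_mirror) (use rng c sz in auto)
    moreover have "(c, a) \<in> right_rel 1 (mirror T) \<longleftrightarrow> (size T + 1 - c, size T + 1 - a) \<in> left_rel 1 T"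
      by (rule right_rel_mirror) (use rng c sz in auto)
    ultimately show False
      using ca c assms left_right_rel_disjoint unfolding compatible_def by fastforce
  qed
  then show ?thesis using sz by (auto simp: compatible_def)
qed

section \<open>The longest chain in a Tamari interval\<close>

text \<open>
  For \<open>D = right_rel k T\<close> these are the Tamari inversions of the interval \<open>[S, T]\<close>. Going up from
  \<open>S\<close> shrinks \<open>left_rel k S\<close>, and every rotation below \<open>T\<close> destroys at least one inversion.
\<close>

definition inversions :: "nat rel \<Rightarrow> nat \<Rightarrow> 'a tree \<Rightarrow> (nat \<times> nat) set" where
  "inversions D k S = {(a, b) \<in> left_rel k S. (b, a) \<in> D}"

lemma finite_inversions [simp]: "finite (inversions D k S)"
  unfolding inversions_def by (rule finite_subset[OF _ finite_left_rel[of k S]]) auto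

lemma card_inversions_Node:
  "card (inversions D k (Node l x r)) = card (inversions D k l) +
    card (inversions D (Suc (k + size l)) r) + card {a \<in> {k..<k + size l}. (k + size l, a) \<in> D}"
proof -
  let ?A = "inversions D k l" and ?B = "inversions D (Suc (k + size l)) r"
  let ?C = "{a \<in> {k..<k + size l}. (k + size l, a) \<in> D} \<times> {k + size l}"
  have "inversions D k (Node l x r) = (?A \<union> ?B) \<union> ?C"
    by (auto simp: inversions_def)
  moreover have "card ((?A \<union> ?B) \<union> ?C) = card (?A \<union> ?B) + card ?C"
    by (intro card_Un_disjoint finite_UnI finite_inversions finite_cartesian_product)
      (auto simp: inversions_def dest: left_rel_range)
  moreover have "card (?A \<union> ?B) = card ?A + card ?B"
    by (intro card_Un_disjoint finite_inversions)
      (fastforce simp: inversions_def dest: left_rel_range)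
  ultimately show ?thesis by (simp add: card_cartesian_product)
qed

section \<open>Effect of right rotations on the two relations\<close>

lemma right_rotation_size: "right_rotation S S' \<Longrightarrow> size S = size S'"
  by (induction rule: right_rotation.induct) auto

lemma right_rotation_right_rel: "right_rotation S S' \<Longrightarrow> right_rel k S \<subseteq> right_rel k S'"
proof (induction arbitrary: k rule: right_rotation.induct)
  case (root A x B y C)
  show ?case by (auto simp: add.assoc)
next
  case (left l l' x r)
  then show ?case using right_rotation_size[OF left(1)] by fastforce
next
  case (right r r' l x)
  then show ?case using right_rotation_size[OF right(1)] by fastforce
qed

text \<open>The lost pair consists of the two ends of the rotated edge. It is an inversion for every
  \<open>D\<close> containing the new right relation, so a rotation below the target always lowers
  the count.\<close>

lemma right_rotation_left_rel:
  "right_rotation S S' \<Longrightarrow> left_rel k S' \<subseteq> left_rel k S \<and>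
    (\<exists>a b. (a, b) \<in> left_rel k S \<and> (a, b) \<notin> left_rel k S' \<and> (b, a) \<in> right_rel k S')"
proof (induction arbitrary: k rule: right_rotation.induct)
  case (root A x B y C)
  let ?a = "k + size A" and ?b = "Suc (k + size A + size B)"
  have "(?a, ?b) \<in> left_rel k (Node (Node A x B) y C)"
    "(?a, ?b) \<notin> left_rel k (Node A x (Node B y C))"
    "(?b, ?a) \<in> right_rel k (Node A x (Node B y C))"
    by (auto dest: left_rel_range)
  moreover have "left_rel k (Node A x (Node B y C)) \<subseteq> left_rel k (Node (Node A x B) y C)"
    by (auto simp: add.assoc)
  ultimately show ?case by blast
next
  case (left l l' x r)
  obtain a b where ab: "(a, b) \<in> left_rel k l" "(a, b) \<notin> left_rel k l'" "(b, a) \<in> right_rel k l'"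
    using left.IH[of k] by blast
  have "(a, b) \<in> left_rel k (Node l x r)" "(a, b) \<notin> left_rel k (Node l' x r)"
    "(b, a) \<in> right_rel k (Node l' x r)"
    using ab right_rel_range[OF ab(3)] by (auto dest: left_rel_range)
  then show ?case using left.IH[of k] right_rotation_size[OF left(1)] by fastforce
next
  case (right r r' l x)
  let ?k = "Suc (k + size l)"
  obtain a b where ab: "(a, b) \<in> left_rel ?k r" "(a, b) \<notin> left_rel ?k r'" "(b, a) \<in> right_rel ?k r'"
    using right.IH[of ?k] by blast
  have "(a, b) \<in> left_rel k (Node l x r)" "(a, b) \<notin> left_rel k (Node l x r')"
    "(b, a) \<in> right_rel k (Node l x r')"
    using ab right_rel_range[OF ab(3)] by (auto dest: left_rel_range)
  then show ?case using right.IH[of ?k] by fastforce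
qed

lemma right_rotation_inversions:
  assumes "right_rotation S S'" "right_rel k S' \<subseteq> D"
  shows "card (inversions D k S') < card (inversions D k S)"
  using right_rotation_left_rel[OF assms(1), of k] assms(2)
  by (intro psubset_card_mono finite_inversions) (auto simp: inversions_def)

lemma tamari_le_size: "tamari_le S T \<Longrightarrow> size S = size T"
  unfolding tamari_le_def by (induction rule: rtranclp_induct) (auto dest: right_rotation_size)

lemma tamari_le_right_rel: "tamari_le S T \<Longrightarrow> right_rel k S \<subseteq> right_rel k T"
  unfolding tamari_le_def
proof (induction rule: rtranclp_induct)
  case (step T T')
  then show ?case using right_rotation_right_rel[OF step.hyps(2), of k] by blast
qed simp

lemma tamari_le_inversions:
  "tamari_le S S' \<Longrightarrow> right_rel k S' \<subseteq> D \<Longrightarrow> card (inversions D k S') \<le> card (inversions D k S)"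
  unfolding tamari_le_def
proof (induction rule: rtranclp_induct)
  case (step S' S'')
  have "right_rel k S' \<subseteq> D" using right_rotation_right_rel[OF step.hyps(2), of k] step.prems by blast
  with step.IH right_rotation_inversions[OF step.hyps(2) step.prems] show ?case by linarith
qed simp

lemma tamari_less_inversions:
  assumes "tamari_less S S'" "right_rel k S' \<subseteq> D"
  shows "card (inversions D k S') < card (inversions D k S)"
proof -
  obtain U where U: "right_rotation S U" "tamari_le U S'"
    using assms(1) unfolding tamari_less_def tamari_le_def by (metis converse_rtranclpE)
  have "right_rel k U \<subseteq> D" using tamari_le_right_rel[OF U(2), of k] assms(2) by blast
  from right_rotation_inversions[OF U(1) this] tamari_le_inversions[OF U(2) assms(2)]
  show ?thesis by linarith
qed

text \<open>The step of a longest chain: rotating the edge at the smallest vertex whose right subtree must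
  still grow removes exactly one inversion.\<close>

lemma right_rotation_step:
  fixes S :: "unit tree"
  assumes "trans D" and convex: "down_convex D"
  shows "right_rel k S \<subseteq> D \<Longrightarrow> k \<le> a \<Longrightarrow> a < b \<Longrightarrow> b < k + size S \<Longrightarrow> (b, a) \<in> D \<Longrightarrow>
    (b, a) \<notin> right_rel k S \<Longrightarrow>
    \<exists>S'. right_rotation S S' \<and> right_rel k S' \<subseteq> D \<and>
      card (inversions D k S) = Suc (card (inversions D k S'))"
proof (induction S arbitrary: k a b)
  case Leaf
  then show ?case by simp
next
  case (Node l x r)
  let ?i = "k + size l"
  have sub: "right_rel k l \<subseteq> D" "right_rel (Suc ?i) r \<subseteq> D" using Node.prems(1) by auto
  \<comment> \<open>Either the left subtree still has to grow, or it is finished and the root must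
    move below one of its vertices, or nothing changes on the left.\<close>
  consider (left) a' b' where "k \<le> a'" "a' < b'" "b' < ?i" "(b', a') \<in> D" "(b', a') \<notin> right_rel k l"
    | (root) a' where "\<And>c d. k \<le> c \<Longrightarrow> c < d \<Longrightarrow> d < ?i \<Longrightarrow> (d, c) \<in> D \<Longrightarrow> (d, c) \<in> right_rel k l"
      "k \<le> a'" "a' < ?i" "(?i, a') \<in> D"
    | (right) "\<And>c d. k \<le> c \<Longrightarrow> c < d \<Longrightarrow> d < ?i \<Longrightarrow> (d, c) \<in> D \<Longrightarrow> (d, c) \<in> right_rel k l"
      "\<And>c. k \<le> c \<Longrightarrow> c < ?i \<Longrightarrow> (?i, c) \<notin> D"
    by blast
  then show ?case
  proof cases
    case left
    obtain l' where l': "right_rotation l l'" "right_rel k l' \<subseteq> D"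
      "card (inversions D k l) = Suc (card (inversions D k l'))"
      using Node.IH(1)[OF sub(1) left] by blast
    note sz = right_rotation_size[OF l'(1)]
    show ?thesis
    proof (intro exI conjI)
      show "right_rotation (Node l x r) (Node l' x r)" by (rule right_rotation.left[OF l'(1)])
      show "right_rel k (Node l' x r) \<subseteq> D" using l'(2) Node.prems(1) sz by auto
      show "card (inversions D k (Node l x r)) = Suc (card (inversions D k (Node l' x r)))"
        using l'(3) sz by (simp add: card_inversions_Node)
    qed
  next
    case root
    then obtain A y B where l: "l = Node A y B" by (cases l) auto
    let ?y = "k + size A"
    \<comment> \<open>With the left subtree finished, a vertex before its root \<open>?y\<close>
      that had to receive \<open>?i\<close> would by convexity already have \<open>?y\<close> in its
      right subtree, which is impossible.\<close>
    have only: "c \<ge> ?y \<and> (c > ?y \<longrightarrow> (c, ?y) \<in> D)" if c: "k \<le> c" "c < ?i" "(?i, c) \<in> D" for c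
    proof (cases c ?y rule: linorder_cases)
      case less
      then have "(?y, c) \<in> right_rel k l" using root(1)[of c ?y] c down_convexD[OF convex c(3), of ?y] l by auto
      then show ?thesis using less l by (auto dest: right_rel_range)
    next
      case greater
      then have "(c, ?y) \<in> right_rel k l" using c l by auto
      then show ?thesis using greater sub by auto
    qed auto
    have iy: "(?i, ?y) \<in> D"
      using only[OF root(2-4)] root(4) transD[OF \<open>trans D\<close>, of ?i a' ?y] by (cases "a' = ?y") auto
    have ny: "(?i, c) \<notin> D" if "k \<le> c" "c < ?y" for c
      using only[of c] that l by auto
    let ?S = "Node A y (Node B x r)"
    have dr: "(c, ?y) \<in> D" if "?i < c" "c < Suc ?i + size r" for c
    proof -
      have "(c, ?i) \<in> D" using Node.prems(1) that by auto
      then show ?thesis using iy transD[OF \<open>trans D\<close>] by blast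
    qed
    have sz: "Suc (?y + size B) = ?i" using l by simp
    have "right_rel k ?S \<subseteq> right_rel k (Node l x r) \<union> {?i..<Suc ?i + size r} \<times> {?y}"
      using l by (auto simp: add.assoc)
    also have "\<dots> \<subseteq> D"
    proof (rule Un_least[OF Node.prems(1)], clarify)
      fix c assume "c \<in> {?i..<Suc ?i + size r}"
      then show "(c, ?y) \<in> D" using iy dr[of c] by (cases "c = ?i") auto
    qed
    finally have "right_rel k ?S \<subseteq> D" .
    moreover have "card (inversions D k (Node l x r)) = Suc (card (inversions D k ?S))"
    proof -
      \<comment> \<open>After the rotation the left subtree of \<open>?i\<close> is
        \<open>B\<close>. By \<open>ny\<close> no vertex of \<open>A\<close> was counted, so only
        \<open>?y\<close> is lost.\<close>
      have "{a \<in> {k..<?i}. (?i, a) \<in> D} = insert ?y {a \<in> {Suc ?y..<?i}. (?i, a) \<in> D}"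
      proof (rule set_eqI)
        fix c
        show "c \<in> {a \<in> {k..<?i}. (?i, a) \<in> D} \<longleftrightarrow> c \<in> insert ?y {a \<in> {Suc ?y..<?i}. (?i, a) \<in> D}"
          using iy ny[of c] sz by (cases c ?y rule: linorder_cases) auto
      qed
      then have "card {a \<in> {k..<?i}. (?i, a) \<in> D} = Suc (card {a \<in> {Suc ?y..<?i}. (?i, a) \<in> D})"
        by simp
      then show ?thesis
        unfolding card_inversions_Node l using sz l by (simp add: card_inversions_Node add.assoc)
    qed
    ultimately show ?thesis using right_rotation.root[of A y B x r] l by blast
  next
    case right
    have cross: "(d, c) \<notin> D" if "k \<le> c" "c < ?i" "?i \<le> d" for c d
      using right(2)[OF that(1,2)] down_convexD[OF convex, of d c ?i] that by (cases "d = ?i") auto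
    have "?i < a"
    proof (rule ccontr)
      assume "\<not> ?i < a"
      then consider "a = ?i" | "a < ?i" "?i \<le> b" | "b < ?i" by linarith
      then show False
      proof cases
        case 1 then show ?thesis using Node.prems by auto
      next
        case 2 then show ?thesis using cross Node.prems by blast
      next
        case 3 then show ?thesis using right(1)[of a b] Node.prems by auto
      qed
    qed
    then obtain r' where r': "right_rotation r r'" "right_rel (Suc ?i) r' \<subseteq> D"
      "card (inversions D (Suc ?i) r) = Suc (card (inversions D (Suc ?i) r'))"
      using Node.IH(2)[OF sub(2), of a b] Node.prems by auto
    note sz = right_rotation_size[OF r'(1)]
    show ?thesis
    proof (intro exI conjI)
      show "right_rotation (Node l x r) (Node l x r')" by (rule right_rotation.right[OF r'(1)])
      show "right_rel k (Node l x r') \<subseteq> D" using r'(2) Node.prems(1) sz by auto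
      show "card (inversions D k (Node l x r)) = Suc (card (inversions D k (Node l x r')))"
        using r'(3) by (simp add: card_inversions_Node)
    qed
  qed
qed

lemma inversions_self: "inversions (right_rel k T) k T = {}"
  using left_right_rel_disjoint by (auto simp: inversions_def)

text \<open>Induction on the number of inversions, with steps from
  \<open>right_rotation_step\<close>. Besides the length, this shows that inclusion of right
  relations suffices for reachability by rotations.\<close>

lemma longest_chain:
  fixes S T :: "unit tree"
  assumes "size S = size T" "right_rel k S \<subseteq> right_rel k T"
  shows "\<exists>c. c 0 = S \<and> c (card (inversions (right_rel k T) k S)) = T \<and>
    (\<forall>i < card (inversions (right_rel k T) k S). right_rotation (c i) (c (Suc i)))"
  using assms
proof (induction "card (inversions (right_rel k T) k S)" arbitrary: S)
  case (0 S)
  \<comment> \<open>A missing pair would allow one more step, and then the count could not be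
    zero.\<close>
  have "right_rel k S = right_rel k T"
  proof (rule ccontr)
    assume "\<not> ?thesis"
    then obtain a b where "(b, a) \<in> right_rel k T" "(b, a) \<notin> right_rel k S" using 0 by auto
    then show False
      using right_rotation_step[OF right_rel_trans[of k T] down_convex_right_rel, where k = k and S = S and a = a and b = b] 0
      by (auto dest: right_rel_range)
  qed
  then have "S = T" using 0 right_rel_inject by blast
  then show ?case using 0 by (intro exI[of _ "\<lambda>_. T"]) auto
next
  case (Suc m S)
  then have "S \<noteq> T" by (auto simp: inversions_self)
  then have "right_rel k S \<noteq> right_rel k T" using Suc.prems right_rel_inject by blast
  then obtain a b where ab: "(b, a) \<in> right_rel k T" "(b, a) \<notin> right_rel k S" using Suc by auto
  obtain S' where S': "right_rotation S S'" "right_rel k S' \<subseteq> right_rel k T"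
    "card (inversions (right_rel k T) k S) = Suc (card (inversions (right_rel k T) k S'))"
    using right_rotation_step[OF right_rel_trans[of k T] down_convex_right_rel Suc.prems(2) _ _ _ ab]
      right_rel_range[OF ab(1)] Suc.prems by auto
  have m: "m = card (inversions (right_rel k T) k S')" using S'(3) Suc.hyps(2) by simp
  have "size S' = size T" using right_rotation_size[OF S'(1)] Suc.prems by simp
  from Suc.hyps(1)[OF m this S'(2)] obtain c where c: "c 0 = S'" "c m = T"
    "\<forall>i < m. right_rotation (c i) (c (Suc i))" using m by auto
  have "(case_nat S c) 0 = S \<and> (case_nat S c) (Suc m) = T \<and>
    (\<forall>i < Suc m. right_rotation ((case_nat S c) i) ((case_nat S c) (Suc i)))"
    using c S'(1) by (auto split: nat.splits)
  then show ?case using Suc.hyps(2) by metis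
qed

lemma tamari_le_iff: "tamari_le S T \<longleftrightarrow> compatible S T"
proof
  assume "tamari_le S T"
  then show "compatible S T"
    using tamari_le_size[of S T] tamari_le_right_rel[of S T 1] unfolding compatible_def by blast
next
  assume "compatible S T"
  then obtain c where c: "c 0 = S" "c (card (inversions (right_rel 1 T) 1 S)) = T"
    "\<forall>i < card (inversions (right_rel 1 T) 1 S). right_rotation (c i) (c (Suc i))"
    using longest_chain[of S T 1] unfolding compatible_def by blast
  have "i \<le> card (inversions (right_rel 1 T) 1 S) \<Longrightarrow> right_rotation\<^sup>*\<^sup>* (c 0) (c i)" for i
    by (induction i) (use c(3) in \<open>auto intro: rtranclp.rtrancl_into_rtrancl\<close>)
  then show "tamari_le S T" using c(1,2) unfolding tamari_le_def by (metis order_refl)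
qed

text \<open>The induction runs downwards from the end of the chain, because a step is known to lose
  an inversion relative to \<open>T\<close> only if its upper tree has its right relation inside
  that of \<open>T\<close>.\<close>

lemma tamari_chain_inversions:
  assumes "c k = T" "\<And>i. i < k \<Longrightarrow> tamari_less (c i) (c (Suc i))" "j \<le> k"
  shows "right_rel 1 (c (k - j)) \<subseteq> right_rel 1 T \<and> j \<le> card (inversions (right_rel 1 T) 1 (c (k - j)))"
  using assms(3)
proof (induction j)
  case 0
  show ?case by (simp add: assms(1))
next
  case (Suc j)
  have eq: "Suc (k - Suc j) = k - j" "k - Suc j < k" using Suc.prems by auto
  from assms(2)[OF eq(2)] have less: "tamari_less (c (k - Suc j)) (c (k - j))"
    unfolding eq(1) .
  then have sub: "right_rel 1 (c (k - Suc j)) \<subseteq> right_rel 1 (c (k - j))"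
    unfolding tamari_less_def by (intro tamari_le_right_rel) (rule conjunct1)
  have "j \<le> k" using Suc.prems by simp
  note IH = Suc.IH[OF this]
  from sub have "right_rel 1 (c (k - Suc j)) \<subseteq> right_rel 1 T"
    by (rule order_trans) (rule conjunct1[OF IH])
  moreover have "Suc j \<le> card (inversions (right_rel 1 T) 1 (c (k - Suc j)))"
    using tamari_less_inversions[OF less conjunct1[OF IH]] conjunct2[OF IH] by linarith
  ultimately show ?case ..
qed

text \<open>Every strict step loses an inversion, which bounds all chains; the rotations of
  \<open>longest_chain\<close> attain the bound. Boundedness also gives the finiteness that
  \<open>Max\<close> requires.\<close>

lemma tamari_dist_inversions:
  assumes "compatible S T"
  shows "tamari_dist S T = card (inversions (right_rel 1 T) 1 S)"
proof -
  define N where "N = card (inversions (right_rel 1 T) 1 S)"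
  define K where "K = {k. \<exists>c :: nat \<Rightarrow> unit tree. c 0 = S \<and> c k = T \<and>
    (\<forall>i < k. tamari_less (c i) (c (Suc i)))}"
  have bound: "k \<le> N" if k: "k \<in> K" for k
  proof -
    from k obtain c :: "nat \<Rightarrow> unit tree" where
      c: "c 0 = S" "c k = T" "\<forall>i < k. tamari_less (c i) (c (Suc i))"
      unfolding K_def mem_Collect_eq by (elim exE conjE)
    have "k \<le> card (inversions (right_rel 1 T) 1 (c (k - k)))"
      by (rule conjunct2[OF tamari_chain_inversions]) (simp_all add: c)
    then show ?thesis by (simp add: c N_def)
  qed
  obtain c where c: "c 0 = S" "c N = T" "\<forall>i < N. right_rotation (c i) (c (Suc i))"
    using assms longest_chain[of S T 1] unfolding compatible_def N_def by (elim conjE) blast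
  have rot: "tamari_less U V" if "right_rotation U V" for U V
    unfolding tamari_less_def tamari_le_def
    using right_rotation_left_rel[OF that, of 1] r_into_rtranclp[of right_rotation, OF that] by blast
  have NK: "N \<in> K"
    unfolding K_def by (intro CollectI exI[of _ c] conjI allI impI rot) (simp_all add: c)
  have "K \<subseteq> {..N}"
    by (rule subsetI) (simp add: bound)
  then have "finite K" by (rule finite_subset) simp
  then have "Max K = N" using bound NK by (rule Max_eqI)
  then show ?thesis unfolding tamari_dist_def K_def N_def .
qed

text \<open>The self-inverse map from \<open>(a, b)\<close> to \<open>(?m - b, ?m - a)\<close>
  exchanges the two conditions on an inversion, since mirroring turns left subtrees into right
  subtrees in both trees.\<close>

lemma inversions_mirror:
  assumes "size S = size T"
  shows "card (inversions (right_rel 1 (mirror S)) 1 (mirror T)) = card (inversions (right_rel 1 T) 1 S)"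
proof -
  let ?m = "size T + 1"
  let ?f = "\<lambda>(a, b). (?m - b, ?m - a)"
  have L: "(a, b) \<in> left_rel 1 (mirror T) \<longleftrightarrow> (a', b') \<in> right_rel 1 T"
    if "a + a' = ?m" "b + b' = ?m" for a b a' b'
    using right_rel_mirror[of b' b 1 1 "mirror T" a' a] that by (simp add: add.commute)
  have R: "(b, a) \<in> right_rel 1 (mirror S) \<longleftrightarrow> (b', a') \<in> left_rel 1 S"
    if "a + a' = ?m" "b + b' = ?m" for a b a' b'
    using right_rel_mirror[of a a' 1 1 S b b'] that assms by simp
  have "bij_betw ?f (inversions (right_rel 1 (mirror S)) 1 (mirror T)) (inversions (right_rel 1 T) 1 S)"
  proof (rule bij_betw_byWitness[where f' = ?f])
    show "\<forall>p\<in>inversions (right_rel 1 (mirror S)) 1 (mirror T). ?f (?f p) = p"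
      by (auto simp: inversions_def dest!: left_rel_range)
    show "\<forall>p\<in>inversions (right_rel 1 T) 1 S. ?f (?f p) = p"
      using assms by (auto simp: inversions_def dest!: left_rel_range)
    show "?f ` inversions (right_rel 1 (mirror S)) 1 (mirror T) \<subseteq> inversions (right_rel 1 T) 1 S"
    proof clarify
      fix a b assume "(a, b) \<in> inversions (right_rel 1 (mirror S)) 1 (mirror T)"
      then have ab: "(a, b) \<in> left_rel 1 (mirror T)" "(b, a) \<in> right_rel 1 (mirror S)"
        by (auto simp: inversions_def)
      have sum: "a + (?m - a) = ?m" "b + (?m - b) = ?m" using left_rel_range[OF ab(1)] by auto
      show "(?m - b, ?m - a) \<in> inversions (right_rel 1 T) 1 S"
        using ab unfolding L[OF sum] R[OF sum] inversions_def by blast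
    qed
    show "?f ` inversions (right_rel 1 T) 1 S \<subseteq> inversions (right_rel 1 (mirror S)) 1 (mirror T)"
    proof clarify
      fix a b assume "(a, b) \<in> inversions (right_rel 1 T) 1 S"
      then have ab: "(a, b) \<in> left_rel 1 S" "(b, a) \<in> right_rel 1 T"
        by (auto simp: inversions_def)
      have sum: "?m - b + b = ?m" "?m - a + a = ?m" using left_rel_range[OF ab(1)] assms by auto
      show "(?m - b, ?m - a) \<in> inversions (right_rel 1 (mirror S)) 1 (mirror T)"
        using ab unfolding L[OF sum, symmetric] R[OF sum, symmetric] inversions_def by blast
    qed
  qed
  then show ?thesis by (rule bij_betw_same_card)
qed

section \<open>Dyck paths and binary trees\<close>

lemma elevation_simps [simp]:
  "elevation [] = 0"
  "elevation (Up # w) = elevation w + 1"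
  "elevation (Down # w) = elevation w - 1"
  "elevation (v @ w) = elevation v + elevation w"
  by (auto simp: elevation_def)

lemma dyck_path_prefix: "dyck_path (u @ v) \<Longrightarrow> 0 \<le> elevation u"
  unfolding dyck_path_def by (metis append_eq_conv_conj le_add1 length_append)

lemma dyck_pathI:
  assumes "\<And>u v. w = u @ v \<Longrightarrow> 0 \<le> elevation u" "elevation w = 0"
  shows "dyck_path w"
  unfolding dyck_path_def using assms by (metis append_take_drop_id)

lemma dyck_path_elevation: "dyck_path w \<Longrightarrow> elevation w = 0"
  by (simp add: dyck_path_def)

fun path_of_tree :: "'a tree \<Rightarrow> step list" where
  "path_of_tree Leaf = []"
| "path_of_tree (Node l x r) = path_of_tree l @ [Up] @ path_of_tree r @ [Down]"

lemma dyck_path_Node: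
  assumes "dyck_path D1" "dyck_path D2"
  shows "dyck_path (D1 @ [Up] @ D2 @ [Down])"
proof (rule dyck_pathI)
  fix u v assume "D1 @ [Up] @ D2 @ [Down] = u @ v"
  then consider w where "D1 = u @ w" | "u = D1" | w t where "u = D1 @ Up # w" "D2 = w @ t"
    | "u = D1 @ Up # D2 @ [Down]"
    by (auto simp: append_eq_append_conv2 Cons_eq_append_conv append_eq_Cons_conv)
  then show "0 \<le> elevation u"
    by cases (use assms dyck_path_prefix in \<open>auto simp: dyck_path_elevation add_nonneg_nonneg\<close>)
qed (use assms in \<open>simp add: dyck_path_elevation\<close>)

lemma dyck_path_path_of_tree [simp]: "dyck_path (path_of_tree T)"
  by (induction T) (auto simp: dyck_path_Node[simplified] intro: dyck_pathI)

lemma tree_of_path_of_tree [simp]: "tree_of_path (path_of_tree T) = T"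
  by (induction T) (auto simp: tree_of_path_append[simplified])

text \<open>\<open>D1\<close> ends at the last non-final return. The next step must rise, the final
  step must fall, and there is no return between them, so \<open>D2\<close> stays
  nonnegative.\<close>

lemma dyck_path_decompose:
  assumes "dyck_path D" "D \<noteq> []"
  obtains D1 D2 where "D = D1 @ [Up] @ D2 @ [Down]" "dyck_path D1" "dyck_path D2"
proof -
  let ?k = "last_return D"
  have k: "?k < length D \<and> elevation (take ?k D) = 0"
    unfolding last_return_def by (rule GreatestI_nat[where k = 0 and b = "length D"]) (use assms in auto)
  have max: "j \<le> ?k" if "j < length D" "elevation (take j D) = 0" for j
    unfolding last_return_def by (rule Greatest_le_nat[where b = "length D"]) (use that in auto)
  define D1 where "D1 = take ?k D"
  obtain s w where sw: "drop ?k D = s # w" using k by (cases "drop ?k D") auto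
  have D: "D = D1 @ s # w" using sw D1_def by (metis append_take_drop_id)
  have e1: "elevation D1 = 0" using k D1_def by simp
  have "0 \<le> elevation (D1 @ [s])" using assms(1) D by (intro dyck_path_prefix[of _ w]) simp
  then have s: "s = Up" using e1 by (cases s) auto
  have "elevation w = -1" using dyck_path_elevation[OF assms(1)] D e1 s by simp
  then obtain D2 t where w: "w = D2 @ [t]" by (cases w rule: rev_cases) auto
  have "0 \<le> elevation (D1 @ s # D2)" using assms(1) D w by (intro dyck_path_prefix[of _ "[t]"]) simp
  then have t: "t = Down" using \<open>elevation w = -1\<close> e1 s w by (cases t) auto
  have "dyck_path D1"
    by (rule dyck_pathI) (use dyck_path_prefix assms(1) D e1 in auto)
  moreover have "dyck_path D2"
  proof (rule dyck_pathI)
    fix u v assume uv: "D2 = u @ v"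
    let ?j = "length D1 + 1 + length u"
    have tk: "take ?j D = D1 @ Up # u" using D s w uv by simp
    have "elevation (take ?j D) \<noteq> 0" using max[of ?j] k D w uv D1_def by fastforce
    moreover have "0 \<le> elevation (D1 @ Up # u)"
      using assms(1) D s w uv by (intro dyck_path_prefix[of _ "v @ [t]"]) simp
    ultimately show "0 \<le> elevation u" using tk e1 by simp
  qed (use \<open>elevation w = -1\<close> w t in simp)
  ultimately show ?thesis using that D s w t by simp
qed

lemma path_of_tree_of_path: "dyck_path D \<Longrightarrow> path_of_tree (tree_of_path D) = D"
proof (induction "length D" arbitrary: D rule: less_induct)
  case less
  show ?case
  proof (cases "D = []")
    case False
    then obtain D1 D2 where D: "D = D1 @ [Up] @ D2 @ [Down]" "dyck_path D1" "dyck_path D2"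
      using dyck_path_decompose less.prems by blast
    with less.hyps[of D1] less.hyps[of D2] show ?thesis by (simp add: tree_of_path_append[simplified])
  qed simp
qed

lemma count_path_of_tree [simp]: "count_list (path_of_tree T) s = size T"
  by (induction T) (cases s; auto)+

lemma path_size_tree: "dyck_path D \<Longrightarrow> path_size D = size (tree_of_path D)"
  unfolding path_size_def by (metis path_of_tree_of_path count_path_of_tree)

section \<open>Tamari intervals as pairs of trees\<close>

lemma set_number_inorder: "set_tree (number_inorder k T) = {k..<k + size T}"
  by (induction k T rule: number_inorder.induct) auto

lemma right_rel_number_inorder:
  "(\<exists>l r. Node l a r \<in> subtrees (number_inorder k T) \<and> b \<in> set_tree r) \<longleftrightarrow> (b, a) \<in> right_rel k T"
proof (induction k T rule: number_inorder.induct)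
  case (2 k l x r)
  have "(\<exists>l' r'. Node l' a r' \<in> subtrees (number_inorder k (Node l x r)) \<and> b \<in> set_tree r') \<longleftrightarrow>
      (a = k + size l \<and> b \<in> set_tree (number_inorder (Suc (k + size l)) r)) \<or>
      (\<exists>l' r'. Node l' a r' \<in> subtrees (number_inorder k l) \<and> b \<in> set_tree r') \<or>
      (\<exists>l' r'. Node l' a r' \<in> subtrees (number_inorder (Suc (k + size l)) r) \<and> b \<in> set_tree r')"
    by auto
  then show ?case unfolding 2 by (auto simp: set_number_inorder)
qed simp

lemma left_rel_number_inorder:
  "(\<exists>l r. Node l b r \<in> subtrees (number_inorder k T) \<and> a \<in> set_tree l) \<longleftrightarrow> (a, b) \<in> left_rel k T"
proof (induction k T rule: number_inorder.induct)
  case (2 k l x r)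
  have "(\<exists>l' r'. Node l' b r' \<in> subtrees (number_inorder k (Node l x r)) \<and> a \<in> set_tree l') \<longleftrightarrow>
      (b = k + size l \<and> a \<in> set_tree (number_inorder k l)) \<or>
      (\<exists>l' r'. Node l' b r' \<in> subtrees (number_inorder k l) \<and> a \<in> set_tree l') \<or>
      (\<exists>l' r'. Node l' b r' \<in> subtrees (number_inorder (Suc (k + size l)) r) \<and> a \<in> set_tree l')"
    by auto
  then show ?case unfolding 2 by (auto simp: set_number_inorder)
qed simp

lemma poset_of_interval_eq:
  assumes "dyck_path D1"
  shows "poset_of_interval (D1, D2) = tree_poset (tree_of_path D1) (tree_of_path D2)"
proof -
  have "{(b, a). a < b \<and> in_right_subtree (tree_of_path D1) b a} = right_rel 1 (tree_of_path D1)"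
    "{(a, b). a < b \<and> in_left_subtree (tree_of_path D2) a b} = left_rel 1 (tree_of_path D2)"
    unfolding in_right_subtree_def in_left_subtree_def right_rel_number_inorder left_rel_number_inorder
    by (auto dest: right_rel_range left_rel_range)
  then show ?thesis using assms by (simp add: tree_poset_def path_size_tree)
qed

lemma tamari_interval_iff:
  "tamari_interval (D1, D2) \<longleftrightarrow>
    dyck_path D1 \<and> dyck_path D2 \<and> compatible (tree_of_path D1) (tree_of_path D2)"
  by (simp add: tamari_le_iff)

text \<open>Needed to evaluate the inverse in \<open>interval_of_poset\<close>: the poset determines
  both trees, and the trees determine their Dyck paths.\<close>

lemma inj_on_poset_of_interval: "inj_on poset_of_interval {J. tamari_interval J}"
proof (rule inj_onI, clarify)
  fix D1 D2 E1 E2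
  assume J: "tamari_interval (D1, D2)" "tamari_interval (E1, E2)"
    "poset_of_interval (D1, D2) = poset_of_interval (E1, E2)"
  then have "tree_of_path D1 = tree_of_path E1 \<and> tree_of_path D2 = tree_of_path E2"
    unfolding tamari_interval_iff compatible_def
    by (intro tree_poset_inject) (auto simp: poset_of_interval_eq simp del: poset_of_interval.simps)
  with J show "D1 = E1 \<and> D2 = E2"
    unfolding tamari_interval_iff by (metis path_of_tree_of_path)
qed

lemma interval_of_tree_poset:
  assumes "compatible S T"
  shows "interval_of_poset (tree_poset S T) = (path_of_tree S, path_of_tree T)"
  unfolding interval_of_poset_def
  by (rule the_inv_into_f_eq[OF inj_on_poset_of_interval])
    (use assms in \<open>auto simp: poset_of_interval_eq tamari_le_iff simp del: poset_of_interval.simps\<close>)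

lemma poset_dist_tree_poset:
  "compatible S T \<Longrightarrow> poset_dist (tree_poset S T) = card (inversions (right_rel 1 T) 1 S)"
  by (simp add: poset_dist_def lower_path_def upper_path_def interval_of_tree_poset tamari_dist_inversions)

section \<open>Contacts and rises\<close>

text \<open>The length of the left branch, which for a lower tree is its number of decreasing
  roots.\<close>

fun root_count :: "'a tree \<Rightarrow> nat" where
  "root_count Leaf = 0"
| "root_count (Node l x r) = Suc (root_count l)"

text \<open>The numbers of decreasing children, in in-order: the decreasing children of a node form
  the left branch of its right subtree.\<close>

fun child_counts :: "'a tree \<Rightarrow> nat list" where
  "child_counts Leaf = []"
| "child_counts (Node l x r) = child_counts l @ [root_count r] @ child_counts r"

lemma length_child_counts [simp]: "length (child_counts T) = size T"
  by (induction T) auto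

text \<open>The last node in in-order has an empty right subtree. The product in a contact monomial
  omits this node, so it always drops an entry 0.\<close>

lemma last_child_counts: "T \<noteq> Leaf \<Longrightarrow> last (child_counts T) = 0"
proof (induction T)
  case (Node l x r)
  then show ?case by (cases r) auto
qed simp

lemma contacts_path_of_tree: "contacts (path_of_tree T) = root_count T"
proof (induction T)
  case Leaf
  then show ?case by (simp add: contacts_def)
next
  case (Node l x r)
  let ?D = "path_of_tree (Node l x r)" and ?n = "length (path_of_tree l)"
  have "{k. k < length ?D \<and> elevation (take k ?D) = 0} =
      insert ?n {k. k < ?n \<and> elevation (take k (path_of_tree l)) = 0}"
  proof (intro set_eqI)
    fix k
    show "k \<in> {k. k < length ?D \<and> elevation (take k ?D) = 0} \<longleftrightarrow>
      k \<in> insert ?n {k. k < ?n \<and> elevation (take k (path_of_tree l)) = 0}"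
    proof (cases "k \<le> ?n")
      case True
      then show ?thesis by (auto simp: dyck_path_elevation)
    next
      case False
      \<comment> \<open>The junction at \<open>?n\<close> is the last non-final return, so no later
        position counts.\<close>
      have "elevation (take k ?D) \<noteq> 0" if "k < length ?D"
        using last_return_append[of "path_of_tree l" "path_of_tree r"] False that
          Greatest_le_nat[of "\<lambda>k. k < length ?D \<and> elevation (take k ?D) = 0" k "length ?D"]
        by (auto simp: last_return_def)
      with False show ?thesis by auto
    qed
  qed
  then show ?case using Node by (simp add: contacts_def)
qed

section \<open>Positions of steps and of their matching steps\<close>

lemma filter_positions: "filter (\<lambda>p. (u @ v) ! p = s) [0..<length u] = filter (\<lambda>p. u ! p = s) [0..<length u]"
  by (rule filter_cong) (auto simp: nth_append)

lemma length_filter_positions: "length (filter (\<lambda>p. u ! p = s) [0..<length u]) = count_list u s"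
proof (induction u rule: rev_induct)
  case (snoc x u)
  then show ?case using filter_positions[of u "[x]" s] by simp
qed simp

lemma step_pos_append:
  assumes "count_list u s = i"
  shows "step_pos s (u @ s # v) (Suc i) = length u"
proof -
  have "[0..<length (u @ s # v)] = [0..<length u] @ length u # [Suc (length u)..<length (u @ s # v)]"
    using upt_add_eq_append[of 0 "length u" "Suc (length v)"] upt_conv_Cons[of "length u" "length (u @ s # v)"]
    by (simp del: upt_Suc)
  then have "filter (\<lambda>p. (u @ s # v) ! p = s) [0..<length (u @ s # v)] =
      filter (\<lambda>p. u ! p = s) [0..<length u] @ length u #
      filter (\<lambda>p. (u @ s # v) ! p = s) [Suc (length u)..<length (u @ s # v)]"
    by (simp add: filter_positions del: upt_Suc)
  then show ?thesis
    unfolding step_pos_def using assms by (simp add: nth_append length_filter_positions del: upt_Suc)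
qed

lemma matching_down_append:
  assumes "dyck_path w"
  shows "matching_down (u @ Up # w @ Down # v) (length u) = length u + 1 + length w"
  unfolding matching_down_def
proof (rule Least_equality)
  show "length u < length u + 1 + length w \<and> length u + 1 + length w < length (u @ Up # w @ Down # v) \<and>
    elevation (take (Suc (length u + 1 + length w)) (u @ Up # w @ Down # v)) =
    elevation (take (length u) (u @ Up # w @ Down # v))"
    using assms by (simp add: dyck_path_elevation)
next
  fix q
  assume q: "length u < q \<and> q < length (u @ Up # w @ Down # v) \<and>
    elevation (take (Suc q) (u @ Up # w @ Down # v)) = elevation (take (length u) (u @ Up # w @ Down # v))"
  show "length u + 1 + length w \<le> q"
  proof (rule ccontr)
    assume "\<not> ?thesis"
    then obtain j where j: "q = length u + j" "j \<le> length w"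
      using q by (metis add.commute less_imp_add_positive less_Suc_eq_le nat_add_left_cancel_less
        add_Suc_right not_le plus_1_eq_Suc)
    have eq: "take (Suc q) (u @ Up # w @ Down # v) = u @ Up # take j w"
      using j by (simp add: Suc_diff_le)
    moreover have "0 \<le> elevation (take j w)" using assms j by (simp add: dyck_path_def)
    ultimately show False using q unfolding eq by simp
  qed
qed

lemma contacts_at_append:
  assumes "dyck_path w" "count_list u Up = i"
  shows "contacts_at (Suc i) (u @ Up # w @ Down # v) = contacts w"
  using step_pos_append[OF assms(2), of "w @ Down # v"] matching_down_append[OF assms(1), of u v]
  by (simp add: contacts_at_def Let_def)

text \<open>The up-step of a node is written after the path of its left subtree, so up-steps occur
  in in-order, and an up-step and its match enclose the path of the right subtree. Here
  \<open>i\<close> counts from 0.\<close>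

lemma path_of_tree_split:
  fixes T :: "'a tree"
  shows "i < size T \<Longrightarrow> \<exists>u (R :: 'a tree) v. path_of_tree T = u @ Up # path_of_tree R @ Down # v \<and>
    count_list u Up = i \<and> root_count R = child_counts T ! i"
proof (induction T arbitrary: i)
  case (Node l x r)
  have "size l < i \<Longrightarrow> i = Suc (size l + (i - Suc (size l))) \<and> i - Suc (size l) < size r"
    using Node.prems by auto
  then consider "i < size l" | "i = size l" | j where "i = Suc (size l + j)" "j < size r"
    by (metis linorder_neqE_nat)
  then show ?case
  proof cases
    case 1
    obtain u v and R :: "'a tree" where "path_of_tree l = u @ Up # path_of_tree R @ Down # v"
      "count_list u Up = i" "root_count R = child_counts l ! i" using Node.IH(1)[OF 1] by blast
    then show ?thesis using 1
      by (intro exI[of _ u] exI[of _ R] exI[of _ "v @ [Up] @ path_of_tree r @ [Down]"])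
        (simp add: nth_append)
  next
    case 2
    then show ?thesis
      by (intro exI[of _ "path_of_tree l"] exI[of _ r] exI[of _ "[]"]) (simp add: nth_append)
  next
    case 3
    obtain u v and R :: "'a tree" where "path_of_tree r = u @ Up # path_of_tree R @ Down # v"
      "count_list u Up = j" "root_count R = child_counts r ! j" using Node.IH(2)[OF 3(2)] by blast
    then show ?thesis using 3
      by (intro exI[of _ "path_of_tree l @ [Up] @ u"] exI[of _ R] exI[of _ "v @ [Down]"])
        (simp add: nth_append)
  qed
qed simp

lemma contacts_at_path_of_tree:
  fixes T :: "'a tree"
  assumes "i < size T"
  shows "contacts_at (Suc i) (path_of_tree T) = child_counts T ! i"
proof -
  obtain u v and R :: "'a tree" where T: "path_of_tree T = u @ Up # path_of_tree R @ Down # v"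
    "count_list u Up = i" "root_count R = child_counts T ! i"
    using path_of_tree_split[OF assms] by blast
  then show ?thesis
    using contacts_at_append[OF dyck_path_path_of_tree T(2), of R v]
    by (simp add: contacts_path_of_tree)
qed

text \<open>The statistics are indexed from 1 and omit the last step, whereas lists start at 0;
  hence \<open>Suc\<close> and \<open>butlast\<close>. With multisets, monomials can be compared up
  to a permutation of the entries.\<close>

lemma prod_nth_butlast:
  assumes "\<And>i. i < length xs \<Longrightarrow> f (Suc i) = xs ! i"
  shows "(\<Prod>i = 1..length xs - 1. X (f i)) = prod_mset (image_mset X (mset (butlast xs)))"
proof -
  have "(\<Prod>i = 1..length xs - 1. X (f i)) = (\<Prod>i < length xs - 1. X (f (Suc i)))"
    by (rule prod.reindex_bij_witness[of _ Suc "\<lambda>i. i - 1"]) auto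
  also have "\<dots> = (\<Prod>i < length (butlast xs). X (butlast xs ! i))"
    using assms by (intro prod.cong) (auto simp: nth_butlast)
  also have "\<dots> = prod_list (map X (butlast xs))"
    by (simp add: prod.list_conv_set_nth atLeast0LessThan)
  finally show ?thesis by (metis mset_map prod_mset_prod_list)
qed

lemma contact_mon_path_of_tree:
  "contact_mon X (path_of_tree T) =
    X (root_count T) * prod_mset (image_mset X (mset (butlast (child_counts T))))"
  using prod_nth_butlast[of "child_counts T" "\<lambda>i. contacts_at i (path_of_tree T)" X]
  by (simp add: contact_mon_def contacts_path_of_tree path_size_def contacts_at_path_of_tree)

section \<open>The rises of a path as a list\<close>

fun rise_list :: "step list \<Rightarrow> nat list" where
  "rise_list [] = []"
| "rise_list (Up # w) = rise_list w"
| "rise_list (Down # w) = rises w # rise_list w"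

lemma rises_simps [simp]: "rises [] = 0" "rises (Up # w) = Suc (rises w)" "rises (Down # w) = 0"
  by (auto simp: rises_def)

lemma rises_append: "v \<noteq> [] \<Longrightarrow> last v = Down \<Longrightarrow> rises (v @ w) = rises v"
  unfolding rises_def by (subst takeWhile_append1[of Down]) (auto dest: last_in_set)

lemma length_rise_list [simp]: "length (rise_list w) = count_list w Down"
  by (induction w rule: rise_list.induct) auto

lemma last_rise_list: "w \<noteq> [] \<Longrightarrow> last w = Down \<Longrightarrow> last (rise_list w) = 0"
proof (induction w rule: rise_list.induct)
  case (3 w)
  then have "rise_list w \<noteq> []" if "w \<noteq> []"
    using that by (metis count_list_0_iff last_ConsR last_in_set length_0_conv length_rise_list)
  with 3 show ?case by (cases "w = []") auto
qed (auto split: if_splits)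

lemma rise_list_split:
  "i < count_list w Down \<Longrightarrow> \<exists>u v. w = u @ Down # v \<and> count_list u Down = i \<and> rises v = rise_list w ! i"
proof (induction w arbitrary: i rule: rise_list.induct)
  case (2 w)
  from "2.IH"[of i] "2.prems" obtain u v
    where "w = u @ Down # v" "count_list u Down = i" "rises v = rise_list w ! i" by fastforce
  then show ?case by (intro exI[of _ "Up # u"] exI[of _ v]) auto
next
  case (3 w)
  show ?case
  proof (cases i)
    case 0
    then show ?thesis by (intro exI[of _ "[]"] exI[of _ w]) auto
  next
    case (Suc j)
    with 3 obtain u v
      where "w = u @ Down # v" "count_list u Down = j" "rises v = rise_list w ! j" by fastforce
    with Suc show ?thesis by (intro exI[of _ "Down # u"] exI[of _ v]) auto
  qed
qed simp

lemma rises_at_eq: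
  assumes "i < count_list w Down"
  shows "rises_at (Suc i) w = rise_list w ! i"
proof -
  obtain u v where uv: "w = u @ Down # v" "count_list u Down = i" "rises v = rise_list w ! i"
    using rise_list_split[OF assms] by blast
  then show ?thesis using step_pos_append[OF uv(2), of v] by (simp add: rises_at_def)
qed

lemma rise_mon_path_of_tree:
  "rise_mon X (path_of_tree T) =
    X (rises (path_of_tree T)) * prod_mset (image_mset X (mset (butlast (rise_list (path_of_tree T)))))"
  using prod_nth_butlast[of "rise_list (path_of_tree T)" "\<lambda>i. rises_at i (path_of_tree T)" X]
  by (simp add: rise_mon_def path_size_def rises_at_eq)

text \<open>The final \<open>Down\<close> of \<open>v\<close> is now followed by the initial run of
  \<open>w\<close>, so one entry 0 becomes \<open>rises w\<close>. The additional 0 on the left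
  avoids multiset subtraction.\<close>

lemma mset_rise_list_append:
  "v \<noteq> [] \<Longrightarrow> last v = Down \<Longrightarrow> add_mset 0 (mset (rise_list (v @ w))) =
    add_mset (rises w) (mset (rise_list v) + mset (rise_list w))"
proof (induction v rule: rise_list.induct)
  case (3 v)
  then show ?case
    by (cases "v = []") (auto simp: rises_append add_mset_commute[of 0])
qed (auto split: if_splits)

lemma last_path_of_tree: "T \<noteq> Leaf \<Longrightarrow> path_of_tree T \<noteq> [] \<and> last (path_of_tree T) = Down"
  by (cases T) auto

lemma mset_butlast_cong:
  assumes "mset xs = mset ys" "xs \<noteq> [] \<Longrightarrow> last xs = last ys"
  shows "mset (butlast xs) = mset (butlast ys)"
proof (cases "xs = []")
  case False
  then have "mset (butlast xs @ [last xs]) = mset (butlast ys @ [last ys])"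
    using assms by (metis append_butlast_last_id mset_zero_iff_right)
  with assms False show ?thesis by simp
qed (use assms in auto)

section \<open>The left branch involution on trees\<close>

lemma size_attach_leftmost [simp]: "size (attach_leftmost T S) = size T + size S"
  by (induction T) auto

lemma size_LB_tree [simp]: "size (LB_tree T) = size T"
  by (induction T) auto

lemma LB_tree_eq_Leaf [simp]: "LB_tree T = Leaf \<longleftrightarrow> T = Leaf"
  by (metis size_LB_tree eq_size_0)

lemma attach_leftmost_Leaf [simp]: "attach_leftmost T Leaf = T"
  by (induction T) auto

lemma attach_leftmost_assoc: "attach_leftmost (attach_leftmost T S) U = attach_leftmost T (attach_leftmost S U)"
  by (induction T) auto

text \<open>\<open>LB_tree\<close> reverses left branches, hence also the order in which they are
  joined. The involution property follows from this.\<close>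

lemma LB_tree_attach_leftmost: "LB_tree (attach_leftmost T S) = attach_leftmost (LB_tree S) (LB_tree T)"
  by (induction T) (auto simp: attach_leftmost_assoc)

lemma LB_tree_LB_tree [simp]: "LB_tree (LB_tree T) = T"
  by (induction T) (auto simp: LB_tree_attach_leftmost)

lemma map_attach_leftmost: "map_tree f (attach_leftmost T S) = attach_leftmost (map_tree f T) (map_tree f S)"
  by (induction T) auto

lemma map_LB_tree: "map_tree f (LB_tree T) = LB_tree (map_tree f T)"
  by (induction T) (auto simp: map_attach_leftmost)

lemma mset_inorder_attach_leftmost:
  "mset (inorder (attach_leftmost T S)) = mset (inorder T) + mset (inorder S)"
  by (induction T) auto

lemma mset_inorder_LB_tree: "mset (inorder (LB_tree T)) = mset (inorder T)"
  by (induction T) (auto simp: mset_inorder_attach_leftmost)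

lemma root_count_mirror_attach_leftmost:
  "T \<noteq> Leaf \<Longrightarrow> root_count (mirror (attach_leftmost T S)) = root_count (mirror T)"
  by (cases T) auto

text \<open>In the mirror image \<open>S\<close> hangs to the right of the rightmost node, whose
  entry 0 becomes the root count of \<open>mirror S\<close>. The form matches
  \<open>mset_rise_list_append\<close>.\<close>

lemma mset_child_counts_mirror_attach_leftmost:
  "T \<noteq> Leaf \<Longrightarrow> add_mset 0 (mset (child_counts (mirror (attach_leftmost T S)))) =
    add_mset (root_count (mirror S)) (mset (child_counts (mirror T)) + mset (child_counts (mirror S)))"
proof (induction T)
  case (Node l x r)
  then show ?case
    by (cases "l = Leaf") (auto simp: root_count_mirror_attach_leftmost add_mset_commute[of 0])
qed simp

text \<open>Both sides obey the same recursion: the value for \<open>l\<close> if \<open>l\<close>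
  is nonempty, and otherwise one more than the value for \<open>r\<close>.\<close>

lemma rises_path_of_tree_LB: "rises (path_of_tree T) = root_count (mirror (LB_tree T))"
proof (induction T)
  case (Node l x r)
  have "rises (path_of_tree r @ [Down]) = rises (path_of_tree r)"
    using last_path_of_tree[of r] rises_append[of "path_of_tree r"] by (cases "r = Leaf") auto
  then show ?case
    using Node last_path_of_tree[of l] rises_append[of "path_of_tree l"]
    by (cases "l = Leaf") (auto simp: root_count_mirror_attach_leftmost)
qed simp

lemma mset_rise_list_LB:
  "mset (rise_list (path_of_tree T)) = mset (child_counts (mirror (LB_tree T)))"
proof (induction T)
  case (Node l x r)
  have r: "rises (path_of_tree r @ [Down]) = rises (path_of_tree r)"
    using last_path_of_tree[of r] rises_append[of "path_of_tree r"] by (cases "r = Leaf") auto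
  have r': "mset (rise_list (path_of_tree r @ [Down])) = add_mset 0 (mset (rise_list (path_of_tree r)))"
    using last_path_of_tree[of r] mset_rise_list_append[of "path_of_tree r" "[Down]"]
    by (cases "r = Leaf") auto
  show ?case
  proof (cases "l = Leaf")
    case True
    then show ?thesis using Node r' by simp
  next
    case False
    then have "add_mset 0 (mset (rise_list (path_of_tree (Node l x r)))) =
        add_mset 0 (mset (child_counts (mirror (LB_tree (Node l x r)))))"
      using Node r r' last_path_of_tree[of l]
      by (simp add: mset_rise_list_append mset_child_counts_mirror_attach_leftmost rises_path_of_tree_LB)
    then show ?thesis by simp
  qed
qed simp

lemma rise_mon_LB: "rise_mon X (path_of_tree T) = contact_mon X (path_of_tree (mirror (LB_tree T)))"
proof -
  have "mset (butlast (rise_list (path_of_tree T))) = mset (butlast (child_counts (mirror (LB_tree T))))"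
  \<comment> \<open>Both lists end in 0, so dropping the last entries preserves equality of the
    multisets.\<close>
  proof (rule mset_butlast_cong[OF mset_rise_list_LB])
    assume "rise_list (path_of_tree T) \<noteq> []"
    then have "T \<noteq> Leaf" by auto
    then show "last (rise_list (path_of_tree T)) = last (child_counts (mirror (LB_tree T)))"
      using last_path_of_tree[of T] last_rise_list[of "path_of_tree T"]
        last_child_counts[of "mirror (LB_tree T)"] by auto
  qed
  then show ?thesis
    by (simp add: rise_mon_path_of_tree contact_mon_path_of_tree rises_path_of_tree_LB)
qed

section \<open>Grafting trees\<close>

abbreviation shape :: "'a tree \<Rightarrow> unit tree" where
  "shape \<equiv> map_tree (\<lambda>_. ())"

fun tree_roots :: "nat \<Rightarrow> 'a tree \<Rightarrow> nat list" where
  "tree_roots k Leaf = []"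
| "tree_roots k (Node l x r) = tree_roots k l @ [k + size l]"

text \<open>The number of vertices lying at or below the first \<open>x\<close> decreasing roots.\<close>

fun covered :: "nat \<Rightarrow> 'a tree \<Rightarrow> nat" where
  "covered x Leaf = 0"
| "covered x (Node l y r) = (if x \<le> root_count l then covered x l else size (Node l y r))"

text \<open>
  The lower tree after grafting: the left branch of a tree lists its decreasing roots, and
  the new node, placed after the forest \<open>A\<close>, takes the first \<open>x\<close> roots of \<open>B\<close> as its children.
\<close>

fun graft_root :: "nat \<Rightarrow> unit tree \<Rightarrow> unit tree \<Rightarrow> unit tree" where
  "graft_root x A Leaf = Node A () Leaf"
| "graft_root x A (Node l y r) =
    (if x \<le> root_count l then Node (graft_root x A l) y r else Node A () (Node l y r))"

fun lower_tree :: "nat tree \<Rightarrow> unit tree" where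
  "lower_tree Leaf = Leaf"
| "lower_tree (Node l x r) = graft_root x (lower_tree l) (lower_tree r)"

lemma length_tree_roots [simp]: "length (tree_roots k T) = root_count T"
  by (induction T) auto

lemma tree_roots_range: "y \<in> set (tree_roots k T) \<Longrightarrow> k \<le> y \<and> y < k + size T"
  by (induction T) auto

lemma sorted_tree_roots: "sorted_wrt (<) (tree_roots k T)"
  by (induction T) (auto simp: sorted_wrt_append dest: tree_roots_range)

lemma tree_roots_iff:
  "y \<in> set (tree_roots k T) \<longleftrightarrow> k \<le> y \<and> y < k + size T \<and> (\<forall>x. (y, x) \<notin> right_rel k T)"
proof (induction k T rule: right_rel.induct)
  case (2 k l x r)
  consider "y < k + size l" | "y = k + size l" | "k + size l < y" by linarith
  then show ?case
  proof cases
    case 1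
    then show ?thesis using 2 by (auto dest: right_rel_range)
  next
    case 2
    then show ?thesis by (auto dest: right_rel_range)
  next
    case 3
    then show ?thesis by (auto dest: tree_roots_range)
  qed
qed simp

lemma covered_le: "covered x T \<le> size T"
  by (induction T) auto

text \<open>Each root together with its right subtree occupies a block of consecutive numbers, and
  the blocks are adjacent, so the first \<open>x\<close> of them fill an initial interval.\<close>

lemma covered_take_roots:
  "z \<in> {k..<k + covered x T} \<longleftrightarrow>
    (\<exists>y \<in> set (take x (tree_roots k T)). z = y \<or> (z, y) \<in> right_rel k T)"
proof (induction T)
  case (Node l a r)
  show ?case
  proof (cases "x \<le> root_count l")
    case True
    have "(z, y) \<in> right_rel k (Node l a r) \<longleftrightarrow> (z, y) \<in> right_rel k l" if "y \<in> set (tree_roots k l)" for y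
      using tree_roots_range[OF that] by (auto dest: right_rel_range)
    then have "(\<exists>y \<in> set (take x (tree_roots k l)). z = y \<or> (z, y) \<in> right_rel k (Node l a r)) \<longleftrightarrow>
        (\<exists>y \<in> set (take x (tree_roots k l)). z = y \<or> (z, y) \<in> right_rel k l)"
      by (intro bex_cong refl disj_cong) (auto dest: in_set_takeD simp del: right_rel.simps)
    moreover have "take x (tree_roots k (Node l a r)) = take x (tree_roots k l)" using True by simp
    moreover have "covered x (Node l a r) = covered x l" using True by simp
    ultimately show ?thesis using Node.IH(1) by (simp only:)
  next
    case False
    have all: "take x (tree_roots k (Node l a r)) = tree_roots k (Node l a r)" using False by simp
    show ?thesis
    proof
      assume z: "z \<in> {k..<k + covered x (Node l a r)}"
      have "\<exists>y \<in> set (tree_roots k T). z = y \<or> (z, y) \<in> right_rel k T"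
        if "k \<le> z" "z < k + size T" for z k and T :: "'a tree"
        using that
      proof (induction T)
        case (Node l x r)
        then show ?case by (cases "z < k + size l") auto
      qed simp
      from this[of k z "Node l a r"] z show "\<exists>y \<in> set (take x (tree_roots k (Node l a r))).
          z = y \<or> (z, y) \<in> right_rel k (Node l a r)" unfolding all using False by simp
    next
      assume "\<exists>y \<in> set (take x (tree_roots k (Node l a r))). z = y \<or> (z, y) \<in> right_rel k (Node l a r)"
      then obtain y where "y \<in> set (tree_roots k (Node l a r))"
        "z = y \<or> (z, y) \<in> right_rel k (Node l a r)" unfolding all by blast
      then have "k \<le> z \<and> z < k + size (Node l a r)"
        using tree_roots_range[of y k "Node l a r"] right_rel_range[of z y k "Node l a r"] by auto
      then show "z \<in> {k..<k + covered x (Node l a r)}" using False by simp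
    qed
  qed
qed simp

lemma size_graft_root [simp]: "size (graft_root x A B) = Suc (size A + size B)"
  by (induction B) auto

lemma size_lower_tree [simp]: "size (lower_tree G) = size G"
  by (induction G) auto

lemma right_rel_graft_root:
  "right_rel k (graft_root x A B) = right_rel k A \<union> right_rel (Suc (k + size A)) B \<union>
    {Suc (k + size A)..<Suc (k + size A) + covered x B} \<times> {k + size A}"
proof (induction B)
  case (Node l y r)
  then show ?case by (cases "x \<le> root_count l") (auto simp: add.assoc)
qed simp

text \<open>The roots of \<open>B\<close> after the first \<open>x\<close> stay on the left branch
  above the new node, so \<open>A\<close> and the new node lie in their left subtrees.\<close>

lemma left_rel_graft_root:
  "left_rel k (graft_root x A B) = left_rel k A \<union> left_rel (Suc (k + size A)) B \<union>
    {k..<k + size A} \<times> {k + size A} \<union>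
    {k..k + size A} \<times> set (drop x (tree_roots (Suc (k + size A)) B))"
proof (induction B)
  case (Node l y r)
  let ?i = "Suc (k + size A)"
  let ?j = "?i + size l"
  show ?case
  proof (cases "x \<le> root_count l")
    case True
    have roots: "set (drop x (tree_roots ?i (Node l y r))) = insert ?j (set (drop x (tree_roots ?i l)))"
      using True by simp
    have interval: "{k..<k + Suc (size A + size l)} = {k..k + size A} \<union> {?i..<?j}" by auto
    have "left_rel k (graft_root x A (Node l y r)) =
      left_rel k (graft_root x A l) \<union> left_rel (Suc ?j) r \<union> {k..<k + Suc (size A + size l)} \<times> {?j}"
      using True by (simp add: add.assoc)
    then show ?thesis
      unfolding Node.IH(1) roots interval left_rel.simps(2)[of ?i l y r] by blast
  next
    case False
    then have "drop x (tree_roots ?i (Node l y r)) = []" by simp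
    moreover have "graft_root x A (Node l y r) = Node A () (Node l y r)" using False by simp
    ultimately show ?thesis unfolding left_rel.simps(2)[of k A "()" "Node l y r"] by simp
  qed
qed simp

lemma root_count_graft_root:
  "x \<le> root_count B \<Longrightarrow> root_count (graft_root x A B) + x = Suc (root_count A + root_count B)"
  by (induction B) auto

lemma child_counts_graft_root:
  "x \<le> root_count B \<Longrightarrow> child_counts (graft_root x A B) = child_counts A @ [x] @ child_counts B"
  by (induction B) (auto simp: le_Suc_eq)

section \<open>Shifted relations and the grafting operations\<close>

lemma shift_Times:
  fixes m :: nat
  shows "{(x + m, y + m) |x y. (x, y) \<in> {i..<j} \<times> {a}} = {i + m..<j + m} \<times> {a + m}"
proof -
  have "{(x + m, y + m) |x y. (x, y) \<in> {i..<j} \<times> {a}} = (\<lambda>x. x + m) ` {i..<j} \<times> {a + m}" by blast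
  then show ?thesis by simp
qed

lemma shift_Un:
  "{(x + m, y + m) |x y. (x, y) \<in> P \<union> Q} =
    {(x + m, y + m) |x y. (x, y) \<in> P} \<union> {(x + m, y + m) |x y. (x, y) \<in> Q}"
  by auto

lemma right_rel_shift: "right_rel (k + m) T = {(b + m, a + m) |b a. (b, a) \<in> right_rel k T}"
proof (induction k T rule: right_rel.induct)
  case (2 k l x r)
  have "Suc (k + m + size l) = Suc (k + size l) + m" by simp
  then show ?case
    unfolding right_rel.simps(2) shift_Un shift_Times "2.IH"[symmetric] by (simp add: ac_simps)
qed simp

lemma left_rel_shift: "left_rel (k + m) T = {(a + m, b + m) |a b. (a, b) \<in> left_rel k T}"
proof (induction k T rule: left_rel.induct)
  case (2 k l x r)
  have "Suc (k + m + size l) = Suc (k + size l) + m" by simp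
  then show ?case
    unfolding left_rel.simps(2) shift_Un shift_Times "2.IH"[symmetric] by (simp add: ac_simps)
qed simp

lemma compatible_shift:
  assumes "compatible S T"
  shows "right_rel (Suc k) S \<subseteq> right_rel (Suc k) T"
  using assms right_rel_shift[of 1 k S] right_rel_shift[of 1 k T] by (auto simp: compatible_def)

lemma compatible_graft_root:
  assumes "compatible A U" "compatible B V"
  shows "compatible (graft_root x A B) (Node U () V)"
  using assms compatible_shift[OF assms(2), of "Suc (size A)"] covered_le[of x B]
  by (auto simp: compatible_def right_rel_graft_root)

lemma trans_tree_poset:
  assumes "compatible S T"
  shows "trans (Id_on {1..size S} \<union> right_rel 1 S \<union> left_rel 1 T)"
  using interval_poset_tree_poset[OF assms]
  by (simp add: tree_poset_def partial_order_on_def preorder_on_def)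

lemma Id_on_shift: "{(x + m, y + m) |x y. (x, y) \<in> Id_on {Suc 0..n}} = Id_on {Suc m..m + n}"
proof -
  have "{(x + m, y + m) |x y. (x, y) \<in> Id_on {Suc 0..n}} = Id_on ((\<lambda>x. x + m) ` {Suc 0..n})"
    by blast
  then show ?thesis by (simp add: add.commute)
qed

lemma tree_poset_shift:
  "{(x + m, y + m) |x y. (x, y) \<in> Id_on {Suc 0..n} \<union> right_rel (Suc 0) S \<union> left_rel (Suc 0) T} =
    Id_on {Suc m..m + n} \<union> right_rel (Suc m) S \<union> left_rel (Suc m) T"
  using right_rel_shift[of 1 m S] left_rel_shift[of 1 m T] unfolding shift_Un Id_on_shift by simp

lemma decreasing_roots_tree_poset:
  assumes "size S = size T"
  shows "sorted_list_of_set (decreasing_roots (tree_poset S T)) = tree_roots 1 S"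
proof -
  have "decreasing_roots (tree_poset S T) = set (tree_roots 1 S)"
    unfolding tree_poset_def decreasing_roots.simps set_eq_iff tree_roots_iff
    by (auto dest: right_rel_range left_rel_range)
  then show ?thesis
    using sorted_tree_roots[of 1 S]
    by (simp add: strict_sorted_iff sorted_list_of_set.idem_if_sorted_distinct)
qed

text \<open>The target relation is transitive, being an interval-poset, and contains the generators;
  conversely each of its pairs is a composition of at most two generators. So it is their transitive
  closure.\<close>

lemma right_graft_unit_poset:
  assumes "compatible B T"
  shows "right_graft unit_poset x (tree_poset B T) = tree_poset (graft_root x Leaf B) (Node Leaf () T)"
proof -
  \<comment> \<open>Vertex 1 is the unit and the vertices of \<open>B\<close> start at 2.
    \<open>E\<close> holds only the listed relations from the first \<open>x\<close> roots to 1,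
    \<open>F\<close> also those that they force.\<close>
  define Q where "Q = {(1, 1)} \<union> (Id_on {2..1 + size B} \<union> right_rel 2 B \<union> left_rel 2 T)"
  define Y where "Y = set (take x (tree_roots 1 B))"
  define E where "E = {(y + 1, 1 :: nat) |y. y \<in> Y}"
  define F where "F = {2..<2 + covered x B} \<times> {1 :: nat}"
  have sz: "size B = size T" using assms by (simp add: compatible_def)
  have c: "compatible (graft_root x Leaf B) (Node Leaf () T)"
    using compatible_graft_root[OF _ assms, of Leaf Leaf] by (simp add: compatible_def)
  have target: "tree_poset (graft_root x Leaf B) (Node Leaf () T) = (Suc (size B), Q \<union> F)"
  proof -
    have "{1..Suc (size B)} = insert 1 {2..1 + size B}" by auto
    then have "Id_on {1..Suc (size B)} = {(1, 1)} \<union> Id_on {2..1 + size B}" by blast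
    moreover have "right_rel 1 (graft_root x Leaf B) = right_rel 2 B \<union> F"
      unfolding right_rel_graft_root F_def by (simp add: numeral_2_eq_2)
    moreover have "left_rel 1 (Node Leaf () T) = left_rel 2 T" by (simp add: numeral_2_eq_2)
    ultimately show ?thesis unfolding tree_poset_def Q_def by auto
  qed
  have tr: "trans (Q \<union> F)"
    using interval_poset_tree_poset[OF c] unfolding target
    by (simp add: partial_order_on_def preorder_on_def)
  have cov: "z + 1 \<in> {2..<2 + covered x B} \<longleftrightarrow> (\<exists>y\<in>Y. z = y \<or> (z, y) \<in> right_rel 1 B)" for z
    using covered_take_roots[of z 1 x B] unfolding Y_def by simp
  have EF: "E \<subseteq> F"
    unfolding E_def F_def using cov by blast
  have FE: "F \<subseteq> (Q \<union> E)\<^sup>+"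
  proof (rule subrelI)
    fix z a assume "(z, a) \<in> F"
    then have z: "z \<in> {2..<2 + covered x B}" and a: "a = 1" by (auto simp: F_def)
    from z have z1: "z = (z - 1) + 1" by auto
    with cov[of "z - 1"] z obtain y where y: "y \<in> Y" "z - 1 = y \<or> (z - 1, y) \<in> right_rel 1 B"
      by metis
    have y1: "(y + 1, 1) \<in> Q \<union> E" using y(1) unfolding E_def by blast
    have "z = y + 1 \<or> (z, y + 1) \<in> right_rel (1 + 1) B"
      using y(2) z1 unfolding right_rel_shift[of 1 1 B] by blast
    then have "z = y + 1 \<or> (z, y + 1) \<in> Q \<union> E" unfolding Q_def one_add_one by blast
    then show "(z, a) \<in> (Q \<union> E)\<^sup>+" unfolding a using y1 by (meson r_into_trancl trancl_into_trancl)
  qed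
  have "(Q \<union> E)\<^sup>+ \<subseteq> (Q \<union> F)\<^sup>+" by (rule trancl_mono_subset) (use EF in blast)
  moreover have "(Q \<union> F)\<^sup>+ = Q \<union> F" using tr by (rule trancl_id)
  moreover have "Q \<subseteq> (Q \<union> E)\<^sup>+" by (intro subrelI r_into_trancl UnI1)
  ultimately have "(Q \<union> E)\<^sup>+ = Q \<union> F" using FE by (intro equalityI Un_least) simp_all
  moreover have "right_graft unit_poset x (tree_poset B T) = (Suc (size B), (Q \<union> E)\<^sup>+)"
  proof -
    have "right_graft unit_poset x (tree_poset B T) = (1 + size B, ({(1, 1)} \<union>
        {(x + 1, y + 1) |x y. (x, y) \<in> Id_on {Suc 0..size B} \<union> right_rel (Suc 0) B \<union> left_rel (Suc 0) T} \<union>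
        {(y + 1, 1) |y. y \<in> set (take x (sorted_list_of_set (decreasing_roots (tree_poset B T))))})\<^sup>+)"
      unfolding tree_poset_def unit_poset_def by simp
    also have "\<dots> = (Suc (size B), (Q \<union> E)\<^sup>+)"
      unfolding decreasing_roots_tree_poset[OF sz] tree_poset_shift Q_def E_def Y_def
      by (simp add: numeral_2_eq_2)
    finally show ?thesis .
  qed
  ultimately show ?thesis unfolding target by simp
qed

text \<open>The generating relation already equals the target relation, which is transitive, so the
  closure adds nothing.\<close>

lemma left_graft_tree_poset:
  assumes "compatible A U" "compatible B V"
  shows "left_graft (tree_poset A U) (tree_poset (graft_root x Leaf B) (Node Leaf () V)) =
    tree_poset (graft_root x A B) (Node U () V)"
proof -
  let ?n = "size A" and ?C = "graft_root x Leaf B" and ?V = "Node Leaf () V"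
  have sz: "size U = ?n" "size V = size B" using assms by (auto simp: compatible_def)
  let ?G = "(Id_on {1..?n} \<union> right_rel 1 A \<union> left_rel 1 U) \<union>
    (Id_on {Suc ?n..?n + Suc (size B)} \<union> right_rel (Suc ?n) ?C \<union> left_rel (Suc ?n) ?V) \<union>
    {(y, ?n + 1) |y. y \<in> {1..?n}}"
  let ?R = "Id_on {1..Suc (?n + size B)} \<union> right_rel 1 (graft_root x A B) \<union> left_rel 1 (Node U () V)"
  have "Id_on {1..Suc (?n + size B)} = Id_on {1..?n} \<union> Id_on {Suc ?n..?n + Suc (size B)}"
    by (auto simp: Id_on_def)
  then have R: "?R = ?G"
    using sz by (auto simp: right_rel_graft_root add.commute)
  have "trans ?R"
    using trans_tree_poset[OF compatible_graft_root[OF assms, of x]] by simp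
  then have "?G\<^sup>+ = ?R" unfolding R by (rule trancl_id)
  moreover have "left_graft (tree_poset A U) (tree_poset ?C ?V) = (?n + Suc (size B), ?G\<^sup>+)"
    using tree_poset_shift[of ?n "Suc (size B)" ?C ?V] unfolding tree_poset_def by simp
  ultimately show ?thesis by (simp add: tree_poset_def)
qed

lemma grafting_tree_simps [simp]:
  "grafting_tree Leaf"
  "grafting_tree (Node l x r) \<longleftrightarrow>
    grafting_tree l \<and> grafting_tree r \<and> x + sum_list (inorder r) \<le> size r"
  by (auto simp: grafting_tree_def)

lemma compatible_lower_tree: "compatible (lower_tree G) (shape G)"
proof (induction G)
  case (Node l x r)
  then show ?case using compatible_graft_root by simp
qed (simp add: compatible_def)

text \<open>This replaces grafting and its closures by tree recursions: increasing relations depend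
  on the shape alone, and the labels enter only through the lower tree.\<close>

lemma graft_inv_eq: "graft_inv G = tree_poset (lower_tree G) (shape G)"
proof (induction G)
  case Leaf
  then show ?case by (simp add: tree_poset_def)
next
  case (Node l x r)
  then show ?case
    using right_graft_unit_poset[OF compatible_lower_tree[of r]]
      left_graft_tree_poset[OF compatible_lower_tree[of l] compatible_lower_tree[of r]] by simp
qed

text \<open>Each node creates one root and absorbs as many roots as its label says. Thus the
  inequality in \<open>grafting_tree\<close> means that enough roots are available on the
  right.\<close>

lemma root_count_lower_tree:
  "grafting_tree G \<Longrightarrow> root_count (lower_tree G) + sum_list (inorder G) = size G"
proof (induction G)
  case (Node l x r)
  then have "root_count (lower_tree (Node l x r)) + x =
      Suc (root_count (lower_tree l) + root_count (lower_tree r))"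
    using root_count_graft_root[of x "lower_tree r" "lower_tree l"] by simp
  with Node show ?case by simp
qed simp

lemma label_le_root_count:
  "grafting_tree (Node l x r) \<Longrightarrow> x \<le> root_count (lower_tree r)"
  using root_count_lower_tree[of r] by simp

text \<open>The labels can be read off the lower tree, so lower tree and shape determine a grafting
  tree.\<close>

lemma child_counts_lower_tree: "grafting_tree G \<Longrightarrow> child_counts (lower_tree G) = inorder G"
proof (induction G)
  case (Node l x r)
  then show ?case using label_le_root_count[OF Node.prems] by (simp add: child_counts_graft_root)
qed simp

lemma tree_eq_if_shape_inorder: "shape G = shape H \<Longrightarrow> inorder G = inorder H \<Longrightarrow> G = H"
proof (induction G arbitrary: H)
  case (Node l x r)
  then obtain l' y r' where H: "H = Node l' y r'" by (cases H) auto
  have sh: "shape l = shape l'" "shape r = shape r'" using Node.prems H by auto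
  have "length (inorder l) = length (inorder l')"
    using sh by (metis length_inorder size_map_tree)
  then show ?case using Node H sh by auto
next
  case Leaf
  then show ?case by (cases H) auto
qed

section \<open>Bijectivity of grafting\<close>

lemma inj_on_graft_inv: "inj_on graft_inv {G. grafting_tree G}"
proof (rule inj_onI, clarify)
  fix G H assume gt: "grafting_tree G" "grafting_tree H" and eq: "graft_inv G = graft_inv H"
  have "lower_tree G = lower_tree H \<and> shape G = shape H"
    using eq unfolding graft_inv_eq by (rule tree_poset_inject) auto
  with gt show "G = H"
    using child_counts_lower_tree tree_eq_if_shape_inorder by metis
qed

lemma graft_graft_inv: "grafting_tree G \<Longrightarrow> graft (graft_inv G) = G"
  unfolding graft_def by (rule the_inv_into_f_f[OF inj_on_graft_inv]) simp

text \<open>By hypothesis no vertex from \<open>k + j\<close> on lies below one of the first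
  \<open>j\<close> vertices. So \<open>k + j\<close> is on the left branch and can be split off as
  the grafted node, \<open>x\<close> being its number of children.\<close>

lemma graft_root_exists:
  "j < size S \<Longrightarrow> (\<And>a b. (b, a) \<in> right_rel k S \<Longrightarrow> a < k + j \<Longrightarrow> b < k + j) \<Longrightarrow>
    \<exists>x A B. S = graft_root x A B \<and> size A = j \<and> x \<le> root_count B"
proof (induction S)
  case (Node l y r)
  consider "j < size l" | "j = size l" | "size l < j" by linarith
  then show ?case
  proof cases
    case 1
    have "b < k + j" if "(b, a) \<in> right_rel k l" "a < k + j" for a b
      by (rule Node.prems(2)[of b a]) (use that in auto)
    with Node.IH(1)[OF 1] obtain x A B where
      "l = graft_root x A B" "size A = j" "x \<le> root_count B" by blast
    then show ?thesis by (intro exI[of _ x] exI[of _ A] exI[of _ "Node B () r"]) simp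
  next
    case 2
    \<comment> \<open>Here the root is the grafted node, and it takes all roots of
      \<open>r\<close>.\<close>
    have "Node l () r = graft_root (root_count r) l r" by (cases r) auto
    with 2 show ?thesis by (metis order_refl old.unit.exhaust)
  next
    case 3
    have "(k + j, k + size l) \<in> right_rel k (Node l y r)" using 3 Node.prems(1) by auto
    from Node.prems(2)[OF this] 3 show ?thesis by simp
  qed
qed simp

text \<open>The root of \<open>T\<close> dictates where \<open>S\<close> is cut. The inclusion of
  right relations supplies the hypothesis of \<open>graft_root_exists\<close> and is inherited by
  both parts.\<close>

lemma grafting_tree_exists:
  fixes T :: "unit tree"
  shows "size S = size T \<Longrightarrow> right_rel k S \<subseteq> right_rel k T \<Longrightarrow>
    \<exists>G. grafting_tree G \<and> lower_tree G = S \<and> shape G = T"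
proof (induction T arbitrary: k S)
  case Leaf
  then show ?case by (intro exI[of _ Leaf]) simp
next
  case (Node l y r)
  have "b < k + size l" if "(b, a) \<in> right_rel k S" "a < k + size l" for a b
  proof -
    have "(b, a) \<in> right_rel k (Node l y r)" using that Node.prems by blast
    with that(2) show ?thesis by (auto dest: right_rel_range)
  qed
  then obtain x A B where S: "S = graft_root x A B" and A: "size A = size l" and x: "x \<le> root_count B"
    using graft_root_exists[of "size l" S k] Node.prems(1) by auto
  have B: "size B = size r" using Node.prems(1) S A by simp
  have sub: "right_rel k A \<union> right_rel (Suc (k + size l)) B \<subseteq> right_rel k (Node l y r)"
    using Node.prems(2) S A by (auto simp: right_rel_graft_root)
  have "right_rel k A \<subseteq> right_rel k l"
  proof (rule subrelI)
    fix b a assume ba: "(b, a) \<in> right_rel k A"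
    with sub have "(b, a) \<in> right_rel k (Node l y r)" by blast
    with right_rel_range[OF ba] A show "(b, a) \<in> right_rel k l" by (auto dest: right_rel_range)
  qed
  from Node.IH(1)[OF A this] obtain G where G: "grafting_tree G" "lower_tree G = A" "shape G = l" by blast
  have "right_rel (Suc (k + size l)) B \<subseteq> right_rel (Suc (k + size l)) r"
  proof (rule subrelI)
    fix b a assume ba: "(b, a) \<in> right_rel (Suc (k + size l)) B"
    with sub have "(b, a) \<in> right_rel k (Node l y r)" by blast
    with right_rel_range[OF ba] show "(b, a) \<in> right_rel (Suc (k + size l)) r"
      by (auto dest: right_rel_range)
  qed
  from Node.IH(2)[OF B this] obtain H where H: "grafting_tree H" "lower_tree H = B" "shape H = r" by blast
  have "x + sum_list (inorder H) \<le> size H" using root_count_lower_tree[OF H(1)] H(2) x by simp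
  then show ?case using G H S by (intro exI[of _ "Node G x H"]) simp
qed

lemma interval_poset_graft_inv:
  assumes "interval_poset I"
  obtains G where "grafting_tree G" "I = graft_inv G"
proof -
  obtain S T where ST: "compatible S T" "I = tree_poset S T" using interval_poset_cases[OF assms] by blast
  then obtain G where "grafting_tree G" "lower_tree G = S" "shape G = T"
    using grafting_tree_exists[of S T 1] unfolding compatible_def by blast
  then show ?thesis using that ST by (simp add: graft_inv_eq)
qed

lemma grafting_tree_attach_leftmost:
  "grafting_tree (attach_leftmost T S) \<longleftrightarrow> grafting_tree T \<and> grafting_tree S"
  by (induction T) auto

lemma sum_list_inorder_LB_tree:
  fixes G :: "nat tree"
  shows "sum_list (inorder (LB_tree G)) = sum_list (inorder G)"
  by (metis mset_inorder_LB_tree sum_mset_sum_list)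

lemma grafting_tree_LB_tree: "grafting_tree G \<Longrightarrow> grafting_tree (LB_tree G)"
  by (induction G) (auto simp: grafting_tree_attach_leftmost sum_list_inorder_LB_tree)

lemma LB_graft_inv: "grafting_tree G \<Longrightarrow> LB (graft_inv G) = graft_inv (LB_tree G)"
  by (simp add: LB_def graft_graft_inv)

section \<open>Statistics of a grafting tree\<close>

text \<open>
  The sum of the slacks in the inequalities defining a grafting tree: for a vertex \<open>a\<close> of the
  upper tree, the decreasing roots of its right subtree that are not children of \<open>a\<close> are exactly
  the \<open>b\<close> for which \<open>(a, b)\<close> is an inversion.
\<close>

fun slack :: "nat tree \<Rightarrow> nat" where
  "slack Leaf = 0"
| "slack (Node l x r) = slack l + slack r + (size r - sum_list (inorder r) - x)"

lemma slack_attach_leftmost: "slack (attach_leftmost T S) = slack T + slack S"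
  by (induction T) auto

lemma slack_LB_tree: "slack (LB_tree G) = slack G"
  by (induction G) (auto simp: slack_attach_leftmost sum_list_inorder_LB_tree)

lemma card_inversions_lower_tree:
  "grafting_tree G \<Longrightarrow> card (inversions (right_rel k G) k (lower_tree G)) = slack G"
proof (induction G arbitrary: k)
  case Leaf
  then show ?case by (simp add: inversions_def)
next
  case (Node l x r)
  let ?i = "k + size l" and ?A = "lower_tree l" and ?B = "lower_tree r"
  let ?P = "inversions (right_rel k l) k ?A" and ?Q = "inversions (right_rel (Suc ?i) r) (Suc ?i) ?B"
  let ?C = "{?i} \<times> set (drop x (tree_roots (Suc ?i) ?B))"
  have roots: "?i < y \<and> y < Suc (?i + size r)" if "y \<in> set (drop x (tree_roots (Suc ?i) ?B))" for y
    using tree_roots_range[OF in_set_dropD[OF that]] by auto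
  \<comment> \<open>The other pairs of \<open>left_rel_graft_root\<close> start in \<open>l\<close>
    and end at or after \<open>?i\<close>; they are no inversions, as right subtrees of vertices of
    \<open>l\<close> stay before \<open>?i\<close>.\<close>
  have "(a, b) \<in> inversions (right_rel k (Node l x r)) k (lower_tree (Node l x r)) \<longleftrightarrow>
      (a, b) \<in> ?P \<union> ?Q \<union> ?C" for a b
    using roots[of b] left_rel_range[of a b k ?A] left_rel_range[of a b "Suc ?i" ?B]
      right_rel_range[of b a k l] right_rel_range[of b a "Suc ?i" r]
    by (auto simp: inversions_def left_rel_graft_root)
  then have "inversions (right_rel k (Node l x r)) k (lower_tree (Node l x r)) = ?P \<union> ?Q \<union> ?C"
    by (intro set_eqI) (simp only: split_paired_all)
  moreover have "card (?P \<union> ?Q \<union> ?C) = card (?P \<union> ?Q) + card ?C"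
  proof (intro card_Un_disjoint finite_UnI finite_inversions)
    have "a \<noteq> ?i" if "(a, b) \<in> ?P \<union> ?Q" for a b
      using that left_rel_range[of a b k ?A] left_rel_range[of a b "Suc ?i" ?B]
      by (auto simp: inversions_def)
    then show "(?P \<union> ?Q) \<inter> ?C = {}" by blast
  qed simp
  moreover have "card (?P \<union> ?Q) = card ?P + card ?Q"
  proof (intro card_Un_disjoint finite_inversions)
    have "a < ?i" if "(a, b) \<in> ?P" for a b
      using that left_rel_range[of a b k ?A] by (auto simp: inversions_def)
    moreover have "?i < a" if "(a, b) \<in> ?Q" for a b
      using that left_rel_range[of a b "Suc ?i" ?B] by (auto simp: inversions_def)
    ultimately show "?P \<inter> ?Q = {}" by fastforce
  qed
  moreover have "card ?C = size r - sum_list (inorder r) - x"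
  proof -
    have "distinct (tree_roots (Suc ?i) ?B)"
      using sorted_tree_roots[of "Suc ?i" ?B] by (simp add: strict_sorted_iff)
    then have "card ?C = root_count ?B - x"
      by (simp add: card_cartesian_product distinct_card)
    then show ?thesis using root_count_lower_tree[of r] Node.prems by simp
  qed
  ultimately show ?case using Node by simp
qed

lemma poset_dist_graft_inv: "grafting_tree G \<Longrightarrow> poset_dist (graft_inv G) = slack G"
  using card_inversions_lower_tree[of G 1]
  by (simp add: graft_inv_eq poset_dist_tree_poset[OF compatible_lower_tree])

lemma poset_dist_compl:
  assumes "compatible S T"
  shows "poset_dist (compl (tree_poset S T)) = poset_dist (tree_poset S T)"
proof -
  have "size S = size T" using assms by (simp add: compatible_def)
  then show ?thesis
    by (simp only: compl_tree_poset poset_dist_tree_poset[OF assms] inversions_mirror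
      poset_dist_tree_poset[OF compatible_mirror[OF assms]])
qed

lemma contacts_graft_inv:
  assumes "grafting_tree G"
  shows "poset_contacts (graft_inv G) = size G - sum_list (inorder G)"
  using root_count_lower_tree[OF assms]
  by (simp add: graft_inv_eq poset_contacts_def lower_path_def
    interval_of_tree_poset[OF compatible_lower_tree] contacts_path_of_tree)

text \<open>Only the size and the multiset of labels enter, and \<open>LB_tree\<close> preserves
  both.\<close>

lemma contact_mon_graft_inv:
  assumes "grafting_tree G"
  shows "poset_contact_mon X (graft_inv G) =
    X (size G - sum_list (inorder G)) * prod_mset (image_mset X (mset (inorder G) - {#0#}))"
proof -
  \<comment> \<open>The last label in in-order is 0, so omitting it removes one 0 from the
    multiset.\<close>
  have "mset (butlast (inorder G)) = mset (inorder G) - {#0#}"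
  proof (cases "G = Leaf")
    case False
    then have "last (inorder G) = 0" "inorder G \<noteq> []"
      using last_child_counts[of "lower_tree G"] child_counts_lower_tree[OF assms]
      by (metis eq_size_0 size_lower_tree, simp)
    then have "inorder G = butlast (inorder G) @ [0]" by (metis append_butlast_last_id)
    then have "mset (inorder G) = mset (butlast (inorder G)) + {#0#}" by (metis mset_append mset_single_iff_right)
    then show ?thesis by simp
  qed simp
  then show ?thesis
    using root_count_lower_tree[OF assms]
    by (simp add: graft_inv_eq poset_contact_mon_def lower_path_def
      interval_of_tree_poset[OF compatible_lower_tree] contact_mon_path_of_tree
      child_counts_lower_tree[OF assms] flip: root_count_lower_tree[OF assms])
qed

lemma LB_preserves:
  assumes "grafting_tree G"
  shows "poset_contacts (graft_inv (LB_tree G)) = poset_contacts (graft_inv G)"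
    "poset_contact_mon X (graft_inv (LB_tree G)) = poset_contact_mon X (graft_inv G)"
    "poset_dist (graft_inv (LB_tree G)) = poset_dist (graft_inv G)"
  using assms grafting_tree_LB_tree[OF assms]
  by (simp_all add: contacts_graft_inv contact_mon_graft_inv poset_dist_graft_inv
    sum_list_inorder_LB_tree mset_inorder_LB_tree slack_LB_tree)

lemma compl_compl:
  assumes "compatible S T"
  shows "compl (compl (tree_poset S T)) = tree_poset S T"
  using assms by (simp add: compl_tree_poset compatible_def)

theorem theorem4p24:
  fixes X :: "nat \<Rightarrow> 'a::comm_monoid_mult"
  shows "\<forall>I. interval_poset I \<longrightarrow>
    interval_poset (beta I) \<and>
    beta (beta I) = I \<and>
    poset_rises I = poset_contacts (beta I) \<and>
    poset_rise_mon X I = poset_contact_mon X (beta I) \<and>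
    poset_dist I = poset_dist (beta I)"
proof (intro allI impI)
  fix I assume "interval_poset I"
  then obtain G where G: "grafting_tree G" "I = graft_inv G" by (rule interval_poset_graft_inv)
  define G' where "G' = LB_tree G"
  have G': "grafting_tree G'" "LB_tree G' = G" using grafting_tree_LB_tree[OF G(1)] by (auto simp: G'_def)
  note c = compatible_lower_tree[of G']
  have compl: "compl (graft_inv G') = tree_poset (mirror (shape G')) (mirror (lower_tree G'))"
    unfolding graft_inv_eq by (rule compl_tree_poset) simp
  then have "interval_poset (compl (graft_inv G'))"
    using interval_poset_tree_poset[OF compatible_mirror[OF c]] by simp
  \<comment> \<open>\<open>H\<close> is the grafting tree of the complement of \<open>LB I\<close>.
    By \<open>compl'\<close> a second application of \<open>beta\<close> retraces the
    construction.\<close>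
  then obtain H where H: "grafting_tree H" "compl (graft_inv G') = graft_inv H"
    by (rule interval_poset_graft_inv)
  have compl': "compl (graft_inv H) = graft_inv G'"
    using compl_compl[OF c] by (simp only: H(2)[symmetric] graft_inv_eq[of G'])
  have b: "beta I = graft_inv (LB_tree H)"
    by (simp add: beta_def G LB_graft_inv H flip: G'_def)
  have "beta (beta I) = I"
    unfolding b by (simp add: beta_def LB_graft_inv grafting_tree_LB_tree H compl' G' G(2))
  moreover have "interval_poset (beta I)"
    unfolding b graft_inv_eq by (rule interval_poset_tree_poset[OF compatible_lower_tree])
  moreover have "poset_dist I = poset_dist (beta I)"
    using LB_preserves(3)[OF G(1)] LB_preserves(3)[OF H(1)] poset_dist_compl[OF c] H(2)
    unfolding b G'_def[symmetric] by (simp add: G(2) flip: graft_inv_eq)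
  moreover have up: "upper_path I = path_of_tree (shape G)"
    by (simp add: upper_path_def G graft_inv_eq interval_of_tree_poset[OF compatible_lower_tree])
  \<comment> \<open>Complementation turns the mirrored upper tree of \<open>LB I\<close> into the
    lower tree, and that upper tree is \<open>LB_tree\<close> of the shape of
    \<open>G\<close>.\<close>
  have low: "lower_path (graft_inv H) = path_of_tree (mirror (LB_tree (shape G)))"
    unfolding H(2)[symmetric] compl lower_path_def interval_of_tree_poset[OF compatible_mirror[OF c]]
    by (simp add: G'_def map_LB_tree)
  \<comment> \<open>The outer \<open>LB\<close> preserves contacts, so the lower path of
    \<open>graft_inv H\<close> suffices.\<close>
  have "poset_rises I = poset_contacts (beta I)"
    unfolding b LB_preserves(1)[OF H(1)]
    by (simp add: poset_rises_def poset_contacts_def up low contacts_path_of_tree rises_path_of_tree_LB)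
  moreover have "poset_rise_mon X I = poset_contact_mon X (beta I)"
    unfolding b LB_preserves(2)[OF H(1)]
    by (simp add: poset_rise_mon_def poset_contact_mon_def up low rise_mon_LB)
  ultimately show "interval_poset (beta I) \<and> beta (beta I) = I \<and>
    poset_rises I = poset_contacts (beta I) \<and> poset_rise_mon X I = poset_contact_mon X (beta I) \<and>
    poset_dist I = poset_dist (beta I)" by blast
qed

end
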